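(* For every integer $m\ge1$, the operators $M^{(\lambda,\boldsymbol\mu)}$, $\lambda>\frac m2$, $\mu_1,\dots,\mu_m>0$, are mutually unitarily inequivalent: if $\lambda,\lambda'>\frac m2$ and $\boldsymbol\mu=(1,\mu_1,\dots,\mu_m)$, $\boldsymbol\mu'=(1,\mu_1',\dots,\mu_m')$ have positive entries and $(\lambda,\boldsymbol\mu)\ne(\lambda',\boldsymbol\mu')$, then $M^{(\lambda,\boldsymbol\mu)}$ and $M^{(\lambda',\boldsymbol\mu')}$ are not unitarily equivalent.
   Context: $\mathbb D$ is the open unit disc in $\mathbb C$. For $\alpha>0$, $A^{(\alpha)}(\mathbb D)$ is the Hilbert space of holomorphic functions on $\mathbb D$ with reproducing kernel $(1-z\bar\omega)^{-2\alpha}$. Let $m\ge1$ be an integer, $\lambda>m/2$ real, $\mu_0=1$, $\mu_1,\dots,\mu_m>0$, $\boldsymbol\mu=(\mu_0,\dots,\mu_m)$. Put $2\lambda_j=2\lambda-m+2j$ for $0\le j\le m$ and $(x)_n=x(x+1)\cdots(x+n-1)$. Vectors in $\mathbb C^{m+1}$ have components indexed by $0,\dots,m$. Define $\Gamma_j:A^{(\lambda_j)}(\mathbb D)\to \mathrm{Hol}(\mathbb D,\mathbb C^{m+1})$ by $(\Gamma_jf)_\ell=\binom{\ell}{j}\frac{1}{(2\lambda_j)_{\ell-j}}f^{(\ell-j)}$ if $\ell\ge j$ and $(\Gamma_jf)_\ell=0$ if $\ell<j$. Each $\Gamma_j$ is injective and the sum of the images of $\Gamma_0,\dots,\Gamma_m$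 is direct. $\mathbf A^{(\lambda,\boldsymbol\mu)}(\mathbb D)$ is this direct sum of images, with the inner product $\langle\sum_j\Gamma_jf_j,\sum_j\Gamma_jg_j\rangle=\sum_j\mu_j^{-2}\langle f_j,g_j\rangle_{A^{(\lambda_j)}}$; it is a Hilbert space of $\mathbb C^{m+1}$-valued holomorphic functions with reproducing kernel $\mathbf B^{(\lambda,\boldsymbol\mu)}=\sum_{j=0}^m\mu_j^2\,\mathbf B^{(\lambda_j)}$, where $\mathbf B^{(\lambda_j)}$ is the reproducing kernel of the image of $\Gamma_j$ equipped with the inner product transferred from $A^{(\lambda_j)}(\mathbb D)$. $M^{(\lambda,\boldsymbol\mu)}$ is the (bounded) operator $f(z)\mapsto zf(z)$ on $\mathbf A^{(\lambda,\boldsymbol\mu)}(\mathbb D)$. *)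

theory Defs
  imports "HOL-Analysis.Analysis" "HOL-Library.Function_Algebras"
begin

text \<open>
  Functions on the disc are total functions that vanish off the disc. A vector in
  \<open>\<complex>\<^sup>m\<^sup>+\<^sup>1\<close> is a function on the naturals that vanishes beyond \<open>m\<close>. Addition of functions,
  of either kind, is the pointwise one of \<^theory>\<open>HOL-Library.Function_Algebras\<close>.
\<close>

record 'v ip_space =
  vecs :: "'v set"
  smul :: "complex \<Rightarrow> 'v \<Rightarrow> 'v"
  ip :: "'v \<Rightarrow> 'v \<Rightarrow> complex"

definition ip_norm :: "'v ip_space \<Rightarrow> 'v \<Rightarrow> real" where
  "ip_norm H x = sqrt (Re (ip H x x))"

definition hilbert_space :: "'v::ab_group_add ip_space \<Rightarrow> bool" where
  "hilbert_space H \<longleftrightarrow>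
     vector_space (smul H) \<and> module.subspace (smul H) (vecs H) \<and>
     (\<forall>x\<in>vecs H. \<forall>y\<in>vecs H. \<forall>z\<in>vecs H. ip H (x + y) z = ip H x z + ip H y z) \<and>
     (\<forall>c. \<forall>x\<in>vecs H. \<forall>y\<in>vecs H. ip H (smul H c x) y = c * ip H x y) \<and>
     (\<forall>x\<in>vecs H. \<forall>y\<in>vecs H. ip H y x = cnj (ip H x y)) \<and>
     (\<forall>x\<in>vecs H. x \<noteq> 0 \<longrightarrow> 0 < Re (ip H x x)) \<and>
     (\<forall>X. (\<forall>n. X n \<in> vecs H) \<and>
          (\<forall>e>0. \<exists>N. \<forall>p\<ge>N. \<forall>q\<ge>N. ip_norm H (X p - X q) < e) \<longrightarrow>
          (\<exists>x\<in>vecs H. (\<lambda>n. ip_norm H (X n - x)) \<longlonglongrightarrow> 0))"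

definition unitary_map :: "'v::ab_group_add ip_space \<Rightarrow> 'w::ab_group_add ip_space \<Rightarrow> ('v \<Rightarrow> 'w) \<Rightarrow> bool" where
  "unitary_map H K U \<longleftrightarrow>
     bij_betw U (vecs H) (vecs K) \<and>
     (\<forall>x\<in>vecs H. \<forall>y\<in>vecs H. U (x + y) = U x + U y) \<and>
     (\<forall>c. \<forall>x\<in>vecs H. U (smul H c x) = smul K c (U x)) \<and>
     (\<forall>x\<in>vecs H. \<forall>y\<in>vecs H. ip K (U x) (U y) = ip H x y)"

definition unitarily_equivalent ::
  "'v::ab_group_add ip_space \<Rightarrow> ('v \<Rightarrow> 'v) \<Rightarrow> 'w::ab_group_add ip_space \<Rightarrow> ('w \<Rightarrow> 'w) \<Rightarrow> bool" where
  "unitarily_equivalent H S K T \<longleftrightarrow>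
     (\<exists>U. unitary_map H K U \<and> (\<forall>x\<in>vecs H. U (S x) = T (U x)))"

abbreviation disc :: "complex set" where
  "disc \<equiv> ball 0 1"

definition reproducing_kernel_space ::
  "complex set \<Rightarrow> (complex \<Rightarrow> complex \<Rightarrow> complex) \<Rightarrow> (complex \<Rightarrow> complex) ip_space \<Rightarrow> bool" where
  "reproducing_kernel_space D K H \<longleftrightarrow>
     hilbert_space H \<and> smul H = (\<lambda>c f z. c * f z) \<and>
     (\<forall>f\<in>vecs H. f holomorphic_on D \<and> (\<forall>z. z \<notin> D \<longrightarrow> f z = 0)) \<and>
     (\<forall>w\<in>D. (\<lambda>z. if z \<in> D then K z w else 0) \<in> vecs H \<and>
            (\<forall>f\<in>vecs H. ip H f (\<lambda>z. if z \<in> D then K z w else 0) = f w))"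

definition disc_kernel :: "real \<Rightarrow> complex \<Rightarrow> complex \<Rightarrow> complex" where
  "disc_kernel \<alpha> z w = (1 - z * cnj w) powr of_real (- 2 * \<alpha>)"

text \<open>
  A kernel determines \<^const>\<open>vecs\<close> and the restriction of \<^const>\<open>ip\<close> to it, so the choice
  only affects irrelevant values of \<^const>\<open>ip\<close> outside the space. Existence for \<open>\<alpha> > 0\<close> is
  \<open>A_space_reproducing_kernel\<close> below; the space is realised by the power series whose
  coefficients are square-summable with weights \<open>n! / (2\<alpha>)\<^sub>n\<close>.
\<close>

definition A_space :: "real \<Rightarrow> (complex \<Rightarrow> complex) ip_space" where
  "A_space \<alpha> = (SOME H. reproducing_kernel_space disc (disc_kernel \<alpha>) H)"

lemma square_summable_mult:
  fixes a b :: "nat \<Rightarrow> complex"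
  assumes "summable (\<lambda>n. (norm (a n))\<^sup>2)" "summable (\<lambda>n. (norm (b n))\<^sup>2)"
  shows "summable (\<lambda>n. norm (a n * b n))" "summable (\<lambda>n. a n * b n)"
proof -
  have "norm (a n * b n) \<le> (norm (a n))\<^sup>2 + (norm (b n))\<^sup>2" for n
  proof -
    have "0 \<le> norm (a n) * norm (b n)"
      by simp
    then show ?thesis
      using sum_squares_bound[of "norm (a n)" "norm (b n)"] unfolding norm_mult by linarith
  qed
  then show "summable (\<lambda>n. norm (a n * b n))"
    by (intro summable_comparison_test'[OF summable_add[OF assms]]) auto
  then show "summable (\<lambda>n. a n * b n)"
    by (rule summable_norm_cancel)
qed

lemma square_summable_add:
  fixes a b :: "nat \<Rightarrow> complex"
  assumes "summable (\<lambda>n. (norm (a n))\<^sup>2)" "summable (\<lambda>n. (norm (b n))\<^sup>2)"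
  shows "summable (\<lambda>n. (norm (a n + b n))\<^sup>2)"
proof -
  have "(norm (a n + b n))\<^sup>2 \<le> 2 * (norm (a n))\<^sup>2 + 2 * (norm (b n))\<^sup>2" for n
  proof -
    have "(norm (a n + b n))\<^sup>2 \<le> (norm (a n) + norm (b n))\<^sup>2"
      by (intro power_mono norm_triangle_ineq) auto
    then show ?thesis
      using sum_squares_bound[of "norm (a n)" "norm (b n)"] by (simp add: power2_sum)
  qed
  then show ?thesis
    by (intro summable_comparison_test'[OF summable_add[OF summable_mult[OF assms(1), of 2]
          summable_mult[OF assms(2), of 2]]]) auto
qed

lemma square_summable_complete:
  fixes A :: "nat \<Rightarrow> nat \<Rightarrow> complex"
  assumes A: "\<And>k. summable (\<lambda>n. (norm (A k n))\<^sup>2)"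
    and Cauchy: "\<And>e. e > 0 \<Longrightarrow> \<exists>N. \<forall>p\<ge>N. \<forall>q\<ge>N. sqrt (\<Sum>n. (norm (A p n - A q n))\<^sup>2) < e"
  obtains L where "summable (\<lambda>n. (norm (L n))\<^sup>2)"
    "(\<lambda>k. sqrt (\<Sum>n. (norm (A k n - L n))\<^sup>2)) \<longlonglongrightarrow> 0"
proof -
  have d: "summable (\<lambda>n. (norm (A p n - A q n))\<^sup>2)" for p q
    using square_summable_add[of "A p" "\<lambda>n. - A q n"] A by simp
  have part: "(\<Sum>n<M. (norm (A p n - A q n))\<^sup>2) \<le> e\<^sup>2"
    if "sqrt (\<Sum>n. (norm (A p n - A q n))\<^sup>2) < e" for p q M e
  proof -
    have "(\<Sum>n<M. (norm (A p n - A q n))\<^sup>2) \<le> (\<Sum>n. (norm (A p n - A q n))\<^sup>2)"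
      by (intro sum_le_suminf d) auto
    also have "\<dots> = (sqrt (\<Sum>n. (norm (A p n - A q n))\<^sup>2))\<^sup>2"
      by (simp add: suminf_nonneg d)
    also have "\<dots> \<le> e\<^sup>2"
      using that by (intro power_mono) (auto intro!: suminf_nonneg d)
    finally show ?thesis .
  qed
  have "Cauchy (\<lambda>k. A k n)" for n
  proof (rule metric_CauchyI)
    fix e :: real assume e: "e > 0"
    obtain N where N: "\<forall>p\<ge>N. \<forall>q\<ge>N. sqrt (\<Sum>n. (norm (A p n - A q n))\<^sup>2) < e / 2"
      using Cauchy[OF half_gt_zero[OF e]] by blast
    have "dist (A p n) (A q n) < e" if "p \<ge> N" "q \<ge> N" for p q
    proof -
      have "(norm (A p n - A q n))\<^sup>2 \<le> (\<Sum>n<Suc n. (norm (A p n - A q n))\<^sup>2)"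
        by (simp add: sum_nonneg)
      also have "\<dots> \<le> (e / 2)\<^sup>2"
        using N that by (intro part) auto
      finally have "norm (A p n - A q n) \<le> e / 2"
        by (rule power2_le_imp_le) (use e in simp)
      then show ?thesis
        using e by (simp add: dist_norm)
    qed
    then show "\<exists>M. \<forall>p\<ge>M. \<forall>q\<ge>M. dist (A p n) (A q n) < e"
      by blast
  qed
  then have "\<exists>l. (\<lambda>k. A k n) \<longlonglongrightarrow> l" for n
    unfolding Cauchy_convergent_iff convergent_def by blast
  then obtain L where L: "\<And>n. (\<lambda>k. A k n) \<longlonglongrightarrow> L n"
    by metis
  have lim: "\<exists>N. \<forall>p\<ge>N. \<forall>M. (\<Sum>n<M. (norm (A p n - L n))\<^sup>2) \<le> e\<^sup>2" if e: "e > 0" for e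
  proof -
    obtain N where N: "\<forall>p\<ge>N. \<forall>q\<ge>N. sqrt (\<Sum>n. (norm (A p n - A q n))\<^sup>2) < e"
      using Cauchy[OF e] by blast
    have "(\<Sum>n<M. (norm (A p n - L n))\<^sup>2) \<le> e\<^sup>2" if "p \<ge> N" for p M
    proof (rule LIMSEQ_le_const2)
      show "(\<lambda>q. \<Sum>n<M. (norm (A p n - A q n))\<^sup>2) \<longlonglongrightarrow> (\<Sum>n<M. (norm (A p n - L n))\<^sup>2)"
        by (intro tendsto_sum tendsto_power tendsto_norm tendsto_diff tendsto_const L)
      have "(\<Sum>n<M. (norm (A p n - A q n))\<^sup>2) \<le> e\<^sup>2" if "q \<ge> N" for q
        using N \<open>p \<ge> N\<close> that by (intro part) auto
      then show "\<exists>N. \<forall>q\<ge>N. (\<Sum>n<M. (norm (A p n - A q n))\<^sup>2) \<le> e\<^sup>2"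
        by blast
    qed
    then show ?thesis by blast
  qed
  have summ: "summable (\<lambda>n. (norm (A p n - L n))\<^sup>2)"
    if "\<forall>M. (\<Sum>n<M. (norm (A p n - L n))\<^sup>2) \<le> e\<^sup>2" for p e
  proof (rule bounded_imp_summable)
    show "(\<Sum>n\<le>M. (norm (A p n - L n))\<^sup>2) \<le> e\<^sup>2" for M
      using that unfolding lessThan_Suc_atMost[symmetric] by blast
  qed simp
  obtain N0 where N0: "\<And>p M. p \<ge> N0 \<Longrightarrow> (\<Sum>n<M. (norm (A p n - L n))\<^sup>2) \<le> 1\<^sup>2"
    using lim[OF zero_less_one] by blast
  show ?thesis
  proof
    have "summable (\<lambda>n. (norm (L n - A N0 n))\<^sup>2)"
      using summ[of N0 1] N0 by (simp add: norm_minus_commute)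
    then show "summable (\<lambda>n. (norm (L n))\<^sup>2)"
      using square_summable_add[OF A[of N0], of "\<lambda>n. L n - A N0 n"] by simp
    show "(\<lambda>k. sqrt (\<Sum>n. (norm (A k n - L n))\<^sup>2)) \<longlonglongrightarrow> 0"
    proof (rule metric_LIMSEQ_I)
      fix e :: real assume e: "e > 0"
      obtain N where N: "\<And>p M. p \<ge> N \<Longrightarrow> (\<Sum>n<M. (norm (A p n - L n))\<^sup>2) \<le> (e / 2)\<^sup>2"
        using lim[OF half_gt_zero[OF e]] by blast
      have "dist (sqrt (\<Sum>n. (norm (A p n - L n))\<^sup>2)) 0 < e" if "p \<ge> N" for p
      proof -
        have s: "summable (\<lambda>n. (norm (A p n - L n))\<^sup>2)"
          using N[OF that] by (intro summ[of p "e / 2"]) blast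
        have "(\<Sum>n. (norm (A p n - L n))\<^sup>2) \<le> (e / 2)\<^sup>2"
          using N[OF that] s by (intro suminf_le_const) auto
        then have "sqrt (\<Sum>n. (norm (A p n - L n))\<^sup>2) \<le> e / 2"
          by (intro real_le_lsqrt) (use e in auto)
        then show ?thesis
          using e s by (simp add: suminf_nonneg)
      qed
      then show "\<exists>N. \<forall>k\<ge>N. dist (sqrt (\<Sum>n. (norm (A k n - L n))\<^sup>2)) 0 < e"
        by blast
    qed
  qed
qed

lemma ex_reproducing_kernel_space:
  fixes c :: "nat \<Rightarrow> real"
  assumes c: "\<And>n. c n > 0"
    and K: "\<And>z w. z \<in> disc \<Longrightarrow> w \<in> disc \<Longrightarrow> (\<lambda>n. of_real (c n) * (z * cnj w) ^ n) sums K z w"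
  shows "\<exists>H. reproducing_kernel_space disc K H"
proof -
  define s where "s n = sqrt (c n)" for n
  have s: "s n > 0" "s n * s n = c n" for n
    using c[of n] by (auto simp: s_def)
  define W where "W = {a::nat \<Rightarrow> complex. summable (\<lambda>n. (norm (a n))\<^sup>2)}"
  define P where "P a = Abs_fps (\<lambda>n. a n * of_real (s n))" for a :: "nat \<Rightarrow> complex"
  define ev where "ev a = (\<lambda>z. if z \<in> disc then eval_fps (P a) z else 0)" for a
  define cf where "cf = inv_into W ev"
  define H where "H = \<lparr>vecs = ev ` W, smul = (\<lambda>c f z. c * f z),
     ip = (\<lambda>f g. \<Sum>n. cf f n * cnj (cf g n))\<rparr>"
  have kW: "(\<lambda>n. of_real (s n) * z ^ n) \<in> W" if "z \<in> disc" for z :: complex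
  proof -
    have "of_real (c n) * (z * cnj z) ^ n = of_real ((norm (of_real (s n) * z ^ n))\<^sup>2)" for n
    proof -
      have "(norm (of_real (s n) * z ^ n))\<^sup>2 = c n * ((norm z)\<^sup>2) ^ n"
        using s(1)[of n]
        by (simp add: norm_mult norm_power power_mult_distrib power2_eq_square flip: s(2))
      then show ?thesis
        by (simp only: of_real_mult of_real_power flip: complex_norm_square)
    qed
    then have "summable (\<lambda>n. complex_of_real ((norm (of_real (s n) * z ^ n))\<^sup>2))"
      using K[OF that that] by (simp add: sums_iff)
    then show ?thesis
      unfolding W_def summable_complex_of_real by simp
  qed
  have sm: "summable (\<lambda>n. a n * of_real (s n) * z ^ n)" if "a \<in> W" "z \<in> disc" for a z
    using square_summable_mult(2)[of a "\<lambda>n. of_real (s n) * z ^ n"] that kW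
    by (simp add: W_def mult.assoc)
  have ev: "ev a z = (\<Sum>n. a n * (of_real (s n) * z ^ n))" if "z \<in> disc" for a z
    using that by (simp add: ev_def eval_fps_def P_def mult.assoc)
  have rad: "fps_conv_radius (P a) \<ge> 1" if "a \<in> W" for a
    unfolding fps_conv_radius_def P_def
    by (rule conv_radius_geI_ex') (use sm[OF that] in simp)
  have inj: "inj_on ev W"
  proof (rule inj_onI)
    fix a b assume ab: "a \<in> W" "b \<in> W" "ev a = ev b"
    have "P a = P b"
    proof (rule eval_fps_eqD)
      show "fps_conv_radius (P a) > 0" "fps_conv_radius (P b) > 0"
        using rad ab by (auto intro: less_le_trans[of _ 1])
      have "eventually (\<lambda>z. z \<in> disc) (nhds (0::complex))"
        by (intro eventually_nhds_in_open) auto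
      then show "eventually (\<lambda>z. eval_fps (P a) z = eval_fps (P b) z) (nhds 0)"
        by eventually_elim (use ab(3) in \<open>auto simp: ev_def fun_eq_iff split: if_splits\<close>)
    qed
    then show "a = b"
      using s by (auto simp: P_def fps_eq_iff fun_eq_iff less_le)
  qed
  have cf: "cf (ev a) = a" if "a \<in> W" for a
    using inj that by (simp add: cf_def)
  have Wadd: "a + b \<in> W" if "a \<in> W" "b \<in> W" for a b
    using that square_summable_add[of a b] by (simp add: W_def)
  have Wscale: "(\<lambda>n. x * a n) \<in> W" if "a \<in> W" for a x
    using that by (auto simp: W_def norm_mult power_mult_distrib intro: summable_mult)
  have W0: "0 \<in> W"
    by (simp add: W_def)
  have evadd: "ev (a + b) = ev a + ev b" if "a \<in> W" "b \<in> W" for a b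
  proof
    show "ev (a + b) z = (ev a + ev b) z" for z
    proof (cases "z \<in> disc")
      case True
      then show ?thesis
        using sm[OF that(1) True] sm[OF that(2) True]
        by (simp add: ev suminf_add algebra_simps)
    qed (simp add: ev_def)
  qed
  have evscale: "ev (\<lambda>n. x * a n) = (\<lambda>z. x * ev a z)" if "a \<in> W" for a x
  proof
    show "ev (\<lambda>n. x * a n) z = x * ev a z" for z
    proof (cases "z \<in> disc")
      case True
      then show ?thesis
        using sm[OF that(1) True] by (simp add: ev suminf_mult mult.assoc)
    qed (simp add: ev_def)
  qed
  have ev0: "ev 0 = 0"
    by (rule ext) (simp add: ev_def eval_fps_def P_def)
  have evdiff: "ev (\<lambda>n. a n - b n) = ev a - ev b" "(\<lambda>n. a n - b n) \<in> W"
    if "a \<in> W" "b \<in> W" for a b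
  proof -
    have eq: "(\<lambda>n. a n - b n) = a + (\<lambda>n. -1 * b n)"
      by (auto simp: fun_eq_iff)
    show "(\<lambda>n. a n - b n) \<in> W"
      unfolding eq by (intro Wadd Wscale that)
    show "ev (\<lambda>n. a n - b n) = ev a - ev b"
      unfolding eq evadd[OF that(1) Wscale[OF that(2)]] evscale[OF that(2)]
      by (simp add: fun_eq_iff)
  qed
  have ipH: "ip H (ev a) (ev b) = (\<Sum>n. a n * cnj (b n))" if "a \<in> W" "b \<in> W" for a b
    using that by (simp add: H_def cf)
  have smi: "summable (\<lambda>n. a n * cnj (b n))" if "a \<in> W" "b \<in> W" for a b
    using that square_summable_mult(2)[of a "\<lambda>n. cnj (b n)"] by (simp add: W_def)
  have ip_self: "ip H (ev a) (ev a) = of_real (\<Sum>n. (norm (a n))\<^sup>2)" if "a \<in> W" for a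
  proof -
    have "(\<lambda>n. of_real ((norm (a n))\<^sup>2) :: complex) sums of_real (\<Sum>n. (norm (a n))\<^sup>2)"
      using that by (intro sums_of_real) (auto simp: W_def summable_sums)
    then show ?thesis
      using that by (simp add: ipH complex_norm_square sums_iff flip: of_real_power)
  qed
  have vecsH: "vecs H = ev ` W" and smulH: "smul H = (\<lambda>c f z. c * f z)"
    by (auto simp: H_def)
  have vs: "vector_space (smul H)"
    unfolding smulH by unfold_locales (auto simp: fun_eq_iff algebra_simps)
  then interpret V: vector_space "smul H" .
  have sub: "V.subspace (vecs H)"
  proof (rule V.subspaceI)
    show "0 \<in> vecs H"
      using W0 ev0 unfolding vecsH by force
    show "x + y \<in> vecs H" if "x \<in> vecs H" "y \<in> vecs H" for x y
      using that evadd Wadd unfolding vecsH by force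
    show "smul H c x \<in> vecs H" if "x \<in> vecs H" for c x
      using that evscale[symmetric] Wscale unfolding vecsH smulH by auto
  qed
  have ip_add: "ip H (x + y) z = ip H x z + ip H y z"
    if xyz: "x \<in> vecs H" "y \<in> vecs H" "z \<in> vecs H" for x y z
  proof -
    obtain a b d where abd: "a \<in> W" "b \<in> W" "d \<in> W" "x = ev a" "y = ev b" "z = ev d"
      using xyz by (auto simp: vecsH)
    then show ?thesis
      using suminf_add[OF smi smi, of a d b d]
      by (simp add: ipH Wadd algebra_simps flip: evadd)
  qed
  have ip_scale: "ip H (smul H r x) y = r * ip H x y"
    if xy: "x \<in> vecs H" "y \<in> vecs H" for r x y
  proof -
    obtain a b where ab: "a \<in> W" "b \<in> W" "x = ev a" "y = ev b"
      using xy by (auto simp: vecsH)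
    have "smul H r x = ev (\<lambda>n. r * a n)"
      using ab by (simp add: smulH evscale)
    then show ?thesis
      using ab suminf_mult[OF smi, of a b r] by (simp add: ipH Wscale mult.assoc)
  qed
  have ip_cnj: "ip H y x = cnj (ip H x y)" if xy: "x \<in> vecs H" "y \<in> vecs H" for x y
  proof -
    obtain a b where ab: "a \<in> W" "b \<in> W" "x = ev a" "y = ev b"
      using xy by (auto simp: vecsH)
    have "(\<lambda>n. cnj (a n * cnj (b n))) sums cnj (\<Sum>n. a n * cnj (b n))"
      unfolding sums_cnj using smi ab by (simp add: summable_sums)
    then show ?thesis
      using ab by (simp add: ipH sums_iff mult.commute)
  qed
  have ip_pos: "0 < Re (ip H x x)" if x: "x \<in> vecs H" "x \<noteq> 0" for x
  proof -
    obtain a where a: "a \<in> W" "x = ev a"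
      using x by (auto simp: vecsH)
    with x ev0 have "a \<noteq> 0"
      by auto
    then obtain i where "a i \<noteq> 0"
      by (auto simp: fun_eq_iff)
    then show ?thesis
      using a by (auto simp: ip_self W_def intro!: suminf_pos2[of _ i])
  qed
  have nrm: "ip_norm H (ev a - ev b) = sqrt (\<Sum>n. (norm (a n - b n))\<^sup>2)"
    if "a \<in> W" "b \<in> W" for a b
    using that by (simp add: ip_norm_def ip_self evdiff flip: evdiff(1))
  have complete: "\<exists>x\<in>vecs H. (\<lambda>n. ip_norm H (X n - x)) \<longlonglongrightarrow> 0"
    if X: "\<forall>n. X n \<in> vecs H" and
      C: "\<forall>e>0. \<exists>N. \<forall>p\<ge>N. \<forall>q\<ge>N. ip_norm H (X p - X q) < e" for X
  proof -
    obtain A where A: "\<And>k. A k \<in> W" "\<And>k. X k = ev (A k)"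
      using X unfolding vecsH image_iff by metis
    have "\<exists>N. \<forall>p\<ge>N. \<forall>q\<ge>N. sqrt (\<Sum>n. (norm (A p n - A q n))\<^sup>2) < e" if "e > 0" for e
      using C that A by (simp add: nrm)
    moreover have "summable (\<lambda>n. (norm (A k n))\<^sup>2)" for k
      using A(1)[of k] by (simp add: W_def)
    ultimately obtain L where L: "summable (\<lambda>n. (norm (L n))\<^sup>2)"
      "(\<lambda>k. sqrt (\<Sum>n. (norm (A k n - L n))\<^sup>2)) \<longlonglongrightarrow> 0"
      using square_summable_complete[of A] by blast
    have LW: "L \<in> W"
      using L by (simp add: W_def)
    then show ?thesis
      using L(2) A by (intro bexI[of _ "ev L"]) (auto simp: nrm vecsH)
  qed
  have "hilbert_space H"
    unfolding hilbert_space_def using vs sub ip_add ip_scale ip_cnj ip_pos complete by blast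
  moreover have "f holomorphic_on disc \<and> (\<forall>z. z \<notin> disc \<longrightarrow> f z = 0)" if f: "f \<in> vecs H" for f
  proof -
    obtain a where a: "a \<in> W" "f = ev a"
      using f by (auto simp: vecsH)
    have "eval_fps (P a) holomorphic_on disc"
      using rad[OF a(1)]
      by (intro holomorphic_intros) (auto simp: in_eball_iff elim!: order.strict_trans2[rotated])
    then have "ev a holomorphic_on disc"
      by (rule holomorphic_transform) (simp add: ev_def)
    then show ?thesis
      using a by (simp add: ev_def)
  qed
  moreover have "(\<lambda>z. if z \<in> disc then K z w else 0) \<in> vecs H \<and>
      (\<forall>f\<in>vecs H. ip H f (\<lambda>z. if z \<in> disc then K z w else 0) = f w)" if w: "w \<in> disc" for w
  proof -
    define k where "k n = of_real (s n) * cnj w ^ n" for n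
    have k: "k \<in> W"
      using kW[of "cnj w"] w by (simp add: k_def[abs_def])
    have evk: "ev k = (\<lambda>z. if z \<in> disc then K z w else 0)"
    proof
      fix z
      have "k n * (of_real (s n) * z ^ n) = of_real (c n) * (z * cnj w) ^ n" for n
        unfolding k_def s(2)[symmetric] by (simp add: power_mult_distrib)
      then show "ev k z = (if z \<in> disc then K z w else 0)"
        using K[of z w] w by (cases "z \<in> disc") (simp_all add: ev sums_iff, simp add: ev_def)
    qed
    have "ip H (ev a) (ev k) = ev a w" if "a \<in> W" for a
      using that k w by (simp add: ipH ev k_def)
    then show ?thesis
      using k unfolding evk[symmetric] vecsH by auto
  qed
  ultimately have "reproducing_kernel_space disc K H"
    unfolding reproducing_kernel_space_def using smulH by blast
  then show ?thesis ..
qed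

theorem A_space_reproducing_kernel:
  assumes "\<alpha> > 0"
  shows "reproducing_kernel_space disc (disc_kernel \<alpha>) (A_space \<alpha>)"
proof -
  have "\<exists>H. reproducing_kernel_space disc (disc_kernel \<alpha>) H"
  proof (rule ex_reproducing_kernel_space)
    show "pochhammer (2 * \<alpha>) n / fact n > 0" for n
      using assms by (simp add: pochhammer_pos)
    fix z w :: complex assume "z \<in> disc" "w \<in> disc"
    then have "norm (- (z * cnj w)) < 1"
      using mult_strict_mono'[of "norm z" 1 "norm w" 1] by (simp add: norm_mult)
    from gen_binomial_complex[OF this, of "of_real (- 2 * \<alpha>)"]
    have "(\<lambda>n. (of_real (- 2 * \<alpha>) gchoose n) * (- (z * cnj w)) ^ n) sums disc_kernel \<alpha> z w"
      by (simp add: disc_kernel_def)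
    moreover have "(of_real (- 2 * \<alpha>) gchoose n) * (- (z * cnj w)) ^ n
        = of_real (pochhammer (2 * \<alpha>) n / fact n) * (z * cnj w) ^ n" for n
    proof -
      have "complex_of_real (- 2 * \<alpha>) gchoose n = (- 1) ^ n * of_real (pochhammer (2 * \<alpha>) n / fact n)"
        unfolding gbinomial_pochhammer by (simp flip: pochhammer_of_real)
      moreover have "(- (z * cnj w)) ^ n = (- 1) ^ n * (z * cnj w) ^ n"
        by (rule power_minus)
      moreover have "(- 1) ^ n * (- 1) ^ n = (1::complex)"
        by (simp flip: power_mult_distrib)
      moreover have "(e * p) * (e * q) = (e * e) * (p * q)" for e p q :: complex
        by (simp only: mult_ac)
      ultimately show ?thesis
        by (simp only: mult_1)
    qed
    ultimately show "(\<lambda>n. of_real (pochhammer (2 * \<alpha>) n / fact n) * (z * cnj w) ^ n) sums disc_kernel \<alpha> z w"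
      by simp
  qed
  then show ?thesis
    unfolding A_space_def by (rule someI_ex)
qed

definition lam_shift :: "real \<Rightarrow> nat \<Rightarrow> nat \<Rightarrow> real" where
  "lam_shift lam m j = (2 * lam - real m + 2 * real j) / 2"

definition Gam :: "real \<Rightarrow> nat \<Rightarrow> nat \<Rightarrow> (complex \<Rightarrow> complex) \<Rightarrow> complex \<Rightarrow> nat \<Rightarrow> complex" where
  "Gam lam m j f = (\<lambda>z l.
     if z \<in> disc \<and> j \<le> l \<and> l \<le> m
     then of_nat (l choose j) * (1 / of_real (pochhammer (2 * lam_shift lam m j) (l - j))) * (deriv ^^ (l - j)) f z
     else 0)"

text \<open>
  The functions \<open>f\<^sub>0, \<dots>, f\<^sub>m\<close> with \<open>F = \<Sum>\<^sub>j \<Gamma>\<^sub>j f\<^sub>j\<close>, which are unique because each \<open>\<Gamma>\<^sub>j\<close> is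
  injective and the sum of the images is direct (\<open>Gam_components_sum\<close> below).
\<close>

definition Gam_components :: "real \<Rightarrow> nat \<Rightarrow> (complex \<Rightarrow> nat \<Rightarrow> complex) \<Rightarrow> nat \<Rightarrow> complex \<Rightarrow> complex" where
  "Gam_components lam m F =
     (THE f. f \<in> (\<Pi>\<^sub>E j\<in>{..m}. vecs (A_space (lam_shift lam m j))) \<and> F = (\<Sum>j\<le>m. Gam lam m j (f j)))"

lemma Gam_components_sum:
  assumes lam: "lam > real m / 2"
    and f: "f \<in> (\<Pi>\<^sub>E j\<in>{..m}. vecs (A_space (lam_shift lam m j)))"
  shows "Gam_components lam m (\<Sum>j\<le>m. Gam lam m j (f j)) = f"
  unfolding Gam_components_def
proof (rule the_equality)
  fix g
  assume g: "g \<in> (\<Pi>\<^sub>E j\<in>{..m}. vecs (A_space (lam_shift lam m j))) \<and>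
    (\<Sum>j\<le>m. Gam lam m j (f j)) = (\<Sum>j\<le>m. Gam lam m j (g j))"
  have off: "h j z = 0"
    if "h \<in> (\<Pi>\<^sub>E j\<in>{..m}. vecs (A_space (lam_shift lam m j)))" "j \<le> m" "z \<notin> disc" for h j z
  proof -
    have "lam_shift lam m j > 0"
      using lam by (simp add: lam_shift_def)
    then have "\<forall>u\<in>vecs (A_space (lam_shift lam m j)). u z = 0"
      using A_space_reproducing_kernel that(3) unfolding reproducing_kernel_space_def by blast
    then show ?thesis
      using that by (auto simp: PiE_iff)
  qed
  have split: "(\<Sum>i\<le>m. Gam lam m i (h i) z j) = (\<Sum>i<j. Gam lam m i (h i) z j) + h j z"
    if "j \<le> m" "z \<in> disc" for h j z
  proof -
    have "(\<Sum>i\<le>m. Gam lam m i (h i) z j) = (\<Sum>i\<le>j. Gam lam m i (h i) z j)"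
      by (rule sum.mono_neutral_right) (use that in \<open>auto simp: Gam_def\<close>)
    then show ?thesis
      using that by (simp add: Gam_def flip: lessThan_Suc_atMost)
  qed
  have apply_sum: "(\<Sum>i\<le>m. Gam lam m i (h i)) z j = (\<Sum>i\<le>m. Gam lam m i (h i) z j)" for h z j
    using sum_comp_morphism[of "\<lambda>F. F z j" "\<lambda>i. Gam lam m i (h i)" "{..m}"] by (simp add: comp_def)
  have "g j = f j" if "j \<le> m" for j
    using that
  proof (induction j rule: less_induct)
    case (less j)
    show ?case
    proof
      fix z
      show "g j z = f j z"
      proof (cases "z \<in> disc")
        case True
        have "(\<Sum>i<j. Gam lam m i (g i) z j) = (\<Sum>i<j. Gam lam m i (f i) z j)"
          using less by (intro sum.cong) auto
        moreover have "(\<Sum>i\<le>m. Gam lam m i (g i) z j) = (\<Sum>i\<le>m. Gam lam m i (f i) z j)"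
          using g by (simp flip: apply_sum)
        ultimately show ?thesis
          using less.prems True by (simp add: split)
      next
        case False
        then show ?thesis
          using off[of f j z] off[of g j z] g f less.prems by simp
      qed
    qed
  qed
  then show "g = f"
    using f g by (intro PiE_ext[where k="{..m}"]) auto
qed (use f in simp)

definition bold_A_space :: "nat \<Rightarrow> real \<Rightarrow> (nat \<Rightarrow> real) \<Rightarrow> (complex \<Rightarrow> nat \<Rightarrow> complex) ip_space" where
  "bold_A_space m lam \<mu> =
     \<lparr>vecs = {\<Sum>j\<le>m. Gam lam m j (f j) |f. \<forall>j\<le>m. f j \<in> vecs (A_space (lam_shift lam m j))},
      smul = (\<lambda>c F z l. c * F z l),
      ip = (\<lambda>F G. \<Sum>j\<le>m. of_real (1 / (\<mu> j)\<^sup>2) *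
              ip (A_space (lam_shift lam m j)) (Gam_components lam m F j) (Gam_components lam m G j))\<rparr>"

definition mult_z :: "(complex \<Rightarrow> nat \<Rightarrow> complex) \<Rightarrow> complex \<Rightarrow> nat \<Rightarrow> complex" where
  "mult_z F = (\<lambda>z l. z * F z l)"

end

theory Submission
  imports Defs "HOL-Complex_Analysis.Complex_Analysis"
begin

text \<open>
  A unitary equivalence \<open>U\<close> of two of the operators \<open>M\<close> and \<open>M'\<close> maps the kernel of \<open>M\<^sup>*\<close> onto the
  kernel of \<open>M'\<^sup>*\<close>. These kernels are spanned by the functions \<open>k\<^sub>w = K\<^sub>0 \<epsilon>\<^sub>w\<close>, \<open>0 \<le> w \<le> m\<close>, which
  are orthogonal and have component 0 equal to \<open>z\<^sup>w\<close>. As \<open>a \<rightarrow> \<infinity>\<close>, the components \<open>\<ge> 1\<close> of a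
  polynomial \<open>F\<close> do not contribute to the leading term of \<open>\<langle>M\<^sup>aF, M\<^sup>aG\<rangle>\<close>, which is
  \<open>R a! / (2\<lambda>\<^sub>0)\<^sub>a\<close> times the inner product of \<open>F\<^sub>0\<close> and \<open>G\<^sub>0\<close> in \<open>L\<^sup>2\<close> of the circle. The growth
  rate determines \<open>\<lambda>\<close>. The limits show that \<open>k\<^sub>w \<mapsto> U k\<^sub>w\<close> induces, up to a constant factor, an
  isometry for the circle inner products of the polynomials of degree at most \<open>m\<close> and of their
  shifts; such a map is a scalar. So \<open>U k\<^sub>w\<close> is a multiple of \<open>k'\<^sub>w\<close> with a factor of constant
  modulus, which is 1 because \<open>\<mu>\<^sub>0 = \<mu>'\<^sub>0\<close>. Hence \<open>\<parallel>k\<^sub>w\<parallel>\<^sup>2 = K(0,0)\<^sub>w\<^sub>w\<close> is the same for both spaces,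
  and these numbers determine \<open>\<mu>\<^sub>1, \<dots>, \<mu>\<^sub>m\<close> successively.
\<close>

section \<open>Inner product spaces\<close>

text \<open>The algebraic clauses of \<open>hilbert_space\<close>, stated apart so that the scalar
  spaces and \<open>bold_A_space\<close> share one calculus.\<close>

locale inner_product_space =
  fixes H :: "'v::ab_group_add ip_space"
  assumes vector_space_smul: "vector_space (smul H)"
    and subspace_vecs: "module.subspace (smul H) (vecs H)"
    and ip_add_left: "x \<in> vecs H \<Longrightarrow> y \<in> vecs H \<Longrightarrow> z \<in> vecs H \<Longrightarrow> ip H (x + y) z = ip H x z + ip H y z"
    and ip_smul_left: "x \<in> vecs H \<Longrightarrow> y \<in> vecs H \<Longrightarrow> ip H (smul H c x) y = c * ip H x y"
    and ip_commute: "x \<in> vecs H \<Longrightarrow> y \<in> vecs H \<Longrightarrow> ip H y x = cnj (ip H x y)"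
    and ip_pos: "x \<in> vecs H \<Longrightarrow> x \<noteq> 0 \<Longrightarrow> 0 < Re (ip H x x)"
begin

sublocale V: vector_space "smul H"
  by (rule vector_space_smul)

lemma zero_vecs [simp]: "0 \<in> vecs H"
  using V.subspace_0[OF subspace_vecs] .

lemma add_vecs [simp]: "x \<in> vecs H \<Longrightarrow> y \<in> vecs H \<Longrightarrow> x + y \<in> vecs H"
  using V.subspace_add[OF subspace_vecs] .

lemma diff_vecs [simp]: "x \<in> vecs H \<Longrightarrow> y \<in> vecs H \<Longrightarrow> x - y \<in> vecs H"
  using V.subspace_diff[OF subspace_vecs] .

lemma smul_vecs [simp]: "x \<in> vecs H \<Longrightarrow> smul H c x \<in> vecs H"
  using V.subspace_scale[OF subspace_vecs] .

lemma sum_vecs: "(\<And>i. i \<in> I \<Longrightarrow> x i \<in> vecs H) \<Longrightarrow> (\<Sum>i\<in>I. x i) \<in> vecs H"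
  using V.subspace_sum[OF subspace_vecs] .

lemma ip_zero_left [simp]: "x \<in> vecs H \<Longrightarrow> ip H 0 x = 0"
  using ip_add_left[of 0 0 x] by simp

lemma ip_zero_right [simp]: "x \<in> vecs H \<Longrightarrow> ip H x 0 = 0"
  using ip_commute[of 0 x] by simp

lemma ip_diff_left:
  assumes "x \<in> vecs H" "y \<in> vecs H" "z \<in> vecs H"
  shows "ip H (x - y) z = ip H x z - ip H y z"
  using ip_add_left[of "x - y" y z] assms by simp

lemma ip_add_right:
  assumes "x \<in> vecs H" "y \<in> vecs H" "z \<in> vecs H"
  shows "ip H x (y + z) = ip H x y + ip H x z"
  using assms ip_commute[of "y + z" x] ip_commute[of y x] ip_commute[of z x]
  by (simp add: ip_add_left)

lemma ip_diff_right:
  assumes "x \<in> vecs H" "y \<in> vecs H" "z \<in> vecs H"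
  shows "ip H x (y - z) = ip H x y - ip H x z"
  using ip_add_right[of x "y - z" z] assms by simp

lemma ip_smul_right:
  assumes "x \<in> vecs H" "y \<in> vecs H"
  shows "ip H x (smul H c y) = cnj c * ip H x y"
  using assms ip_commute[of "smul H c y" x] ip_commute[of y x] by (simp add: ip_smul_left)

lemma ip_sum_left:
  assumes "\<And>i. i \<in> I \<Longrightarrow> x i \<in> vecs H" "y \<in> vecs H"
  shows "ip H (\<Sum>i\<in>I. x i) y = (\<Sum>i\<in>I. ip H (x i) y)"
  using assms by (induction I rule: infinite_finite_induct) (auto simp: ip_add_left sum_vecs)

lemma ip_sum_right:
  assumes "\<And>i. i \<in> I \<Longrightarrow> x i \<in> vecs H" "y \<in> vecs H"
  shows "ip H y (\<Sum>i\<in>I. x i) = (\<Sum>i\<in>I. ip H y (x i))"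
  using assms by (induction I rule: infinite_finite_induct) (auto simp: ip_add_right sum_vecs)

lemma ip_self:
  assumes "x \<in> vecs H"
  shows "ip H x x = of_real (Re (ip H x x))" "Re (ip H x x) \<ge> 0"
proof -
  show "ip H x x = of_real (Re (ip H x x))"
    using arg_cong[OF ip_commute[OF assms assms], of Im] by (simp add: complex_eq_iff)
  show "Re (ip H x x) \<ge> 0"
    using ip_pos[OF assms] assms by (cases "x = 0") auto
qed

lemma ip_self_eq_0: "x \<in> vecs H \<Longrightarrow> ip H x x = 0 \<Longrightarrow> x = 0"
  using ip_pos[of x] by force

lemma Cauchy_Schwarz:
  assumes x: "x \<in> vecs H" and y: "y \<in> vecs H"
  shows "norm (ip H x y) \<le> ip_norm H x * ip_norm H y"
proof (cases "y = 0")
  case False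
  define b where "b = Re (ip H y y)"
  \<comment> \<open>\<open>smul H t y\<close> is the orthogonal projection of \<open>x\<close> to
    the line of \<open>y\<close>; the inequality is the nonnegativity of the squared length of the
    remainder.\<close>
  define t where "t = ip H x y / of_real b"
  have b: "ip H y y = of_real b" "b > 0"
    unfolding b_def by (rule ip_self(1)[OF y], rule ip_pos[OF y False])
  have yx: "ip H y x = cnj (ip H x y)"
    by (rule ip_commute[OF x y])
  have "ip H (x - smul H t y) (x - smul H t y)
      = ip H x x - cnj t * ip H x y - t * cnj (ip H x y) + t * cnj t * of_real b"
    using x y by (simp add: ip_diff_left ip_diff_right ip_smul_left ip_smul_right yx b algebra_simps)
  also have "\<dots> = ip H x x - ip H x y * cnj (ip H x y) / of_real b"
    using b(2) by (simp add: t_def field_simps)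
  also have "\<dots> = of_real (Re (ip H x x) - (norm (ip H x y))\<^sup>2 / b)"
    by (simp add: complex_norm_square ip_self(1)[OF x, symmetric] del: of_real_power flip: of_real_power)
  finally have "Re (ip H x x) - (norm (ip H x y))\<^sup>2 / b \<ge> 0"
    using ip_self(2)[of "x - smul H t y"] x y by simp
  then have "(norm (ip H x y))\<^sup>2 \<le> Re (ip H x x) * b"
    using b(2) by (simp add: field_simps)
  then have "norm (ip H x y) \<le> sqrt (Re (ip H x x) * b)"
    by (rule real_le_rsqrt)
  then show ?thesis
    by (simp add: ip_norm_def b_def real_sqrt_mult)
qed (use x in \<open>simp add: ip_norm_def\<close>)

lemma tendsto_ip_left:
  assumes X: "\<And>n. X n \<in> vecs H" "x \<in> vecs H" and y: "y \<in> vecs H"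
    and lim: "(\<lambda>n. ip_norm H (X n - x)) \<longlonglongrightarrow> 0"
  shows "(\<lambda>n. ip H (X n) y) \<longlonglongrightarrow> ip H x y"
proof -
  have "(\<lambda>n. ip H (X n) y - ip H x y) \<longlonglongrightarrow> 0"
  proof (rule Lim_null_comparison)
    show "\<forall>\<^sub>F n in sequentially. norm (ip H (X n) y - ip H x y) \<le> ip_norm H (X n - x) * ip_norm H y"
      using Cauchy_Schwarz[of "X _ - x" y] X y by (simp add: ip_diff_left)
    show "(\<lambda>n. ip_norm H (X n - x) * ip_norm H y) \<longlonglongrightarrow> 0"
      using lim by (rule tendsto_mult_left_zero)
  qed
  then show ?thesis
    by (simp add: LIM_zero_iff)
qed

end

section \<open>Reproducing kernels given by power series\<close>

definition taylor :: "(complex \<Rightarrow> complex) \<Rightarrow> nat \<Rightarrow> complex" where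
  "taylor f n = (deriv ^^ n) f 0 / fact n"

lemma taylor_sums: "f holomorphic_on disc \<Longrightarrow> z \<in> disc \<Longrightarrow> (\<lambda>n. taylor f n * z ^ n) sums f z"
  using holomorphic_power_series[of f 0 1 z] by (simp add: taylor_def)

lemma power_series_taylor:
  assumes "\<And>z. z \<in> disc \<Longrightarrow> (\<lambda>n. a n * z ^ n) sums f z"
  shows "f holomorphic_on disc" "taylor f n = a n"
proof -
  show "f holomorphic_on disc"
    using assms power_series_holomorphic[of 0 1 a f] by simp
  have rad: "fps_conv_radius (Abs_fps a) \<ge> 1"
    unfolding fps_conv_radius_def
    by (rule conv_radius_geI_ex') (use assms in \<open>auto simp: sums_iff dist_norm\<close>)
  have "f has_fps_expansion Abs_fps a"
    unfolding has_fps_expansion_def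
  proof
    show "0 < fps_conv_radius (Abs_fps a)"
      using rad by (auto intro: less_le_trans[of _ 1])
    have "eventually (\<lambda>z. z \<in> disc) (nhds (0::complex))"
      by (intro eventually_nhds_in_open) auto
    then show "\<forall>\<^sub>F z in nhds 0. eval_fps (Abs_fps a) z = f z"
      by eventually_elim (use assms in \<open>auto simp: eval_fps_def sums_iff\<close>)
  qed
  from fps_nth_fps_expansion[OF this, of n] show "taylor f n = a n"
    by (simp add: taylor_def)
qed

text \<open>Dividing the remainder by \<open>z ^ n\<close> leaves a power series with constant term
  \<open>a n\<close>, whose sum is continuous at 0.\<close>

lemma power_series_remainder_tendsto:
  fixes a :: "nat \<Rightarrow> complex"
  assumes s: "s > 0" and f: "\<And>z. norm z < s \<Longrightarrow> (\<lambda>p. a p * z ^ p) sums f z"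
  shows "((\<lambda>z. (f z - (\<Sum>p<n. a p * z ^ p)) / z ^ n) \<longlongrightarrow> a n) (at 0)"
proof -
  have "((\<lambda>z. (f z - (\<Sum>p<n. a p * z ^ p)) / z ^ n) \<longlongrightarrow> a (0 + n)) (at 0)"
  proof (rule powser_limit_0_strong[OF s])
    fix z :: complex assume z: "z \<noteq> 0" "norm z < s"
    have "(\<lambda>p. a (p + n) * z ^ (p + n)) sums (f z - (\<Sum>p<n. a p * z ^ p))"
      using f[of z] z by (subst sums_iff_shift) auto
    then have "(\<lambda>p. a (p + n) * z ^ (p + n) / z ^ n) sums ((f z - (\<Sum>p<n. a p * z ^ p)) / z ^ n)"
      by (rule sums_divide)
    then show "(\<lambda>p. a (p + n) * z ^ p) sums ((f z - (\<Sum>p<n. a p * z ^ p)) / z ^ n)"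
      using z by (simp add: power_add)
  qed
  then show ?thesis by simp
qed

definition zpow :: "nat \<Rightarrow> complex \<Rightarrow> complex" where
  "zpow n z = (if z \<in> disc then z ^ n else 0)"

lemma taylor_zpow: "taylor (zpow n) p = (if p = n then 1 else 0)"
proof (rule power_series_taylor(2))
  show "(\<lambda>p. (if p = n then 1 else 0) * z ^ p) sums zpow n z" if "z \<in> disc" for z
    using sums_single[of n "\<lambda>p. z ^ p"] that
    by (simp add: zpow_def if_distrib[of "\<lambda>x. x * _"] cong: if_cong)
qed

text \<open>\<open>A_space\<close> is an arbitrary choice of a space with the given kernel, so its
  structure has to be recovered from the reproducing property. The aim is orthogonality of the
  monomials and a description of \<open>vecs H\<close> by Taylor coefficients.\<close>

locale power_series_rkhs =
  fixes H :: "(complex \<Rightarrow> complex) ip_space" and c :: "nat \<Rightarrow> real" and K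
  assumes rk: "reproducing_kernel_space disc K H"
    and c_pos: "c n > 0"
    and K_sums: "z \<in> disc \<Longrightarrow> w \<in> disc \<Longrightarrow> (\<lambda>n. of_real (c n) * (z * cnj w) ^ n) sums K z w"
begin

sublocale inner_product_space H
proof (rule inner_product_space.intro)
  have "hilbert_space H"
    using rk by (simp add: reproducing_kernel_space_def)
  note h = this[unfolded hilbert_space_def]
  show "vector_space (smul H)" "module.subspace (smul H) (vecs H)"
    using h by blast+
  show "ip H (x + y) z = ip H x z + ip H y z" if "x \<in> vecs H" "y \<in> vecs H" "z \<in> vecs H" for x y z
    using h that by blast
  show "ip H (smul H r x) y = r * ip H x y" "ip H y x = cnj (ip H x y)"
    if "x \<in> vecs H" "y \<in> vecs H" for x y r
    using h that by blast+
  show "0 < Re (ip H x x)" if "x \<in> vecs H" "x \<noteq> 0" for x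
    using h that by blast
qed

lemma c_nonzero [simp]: "c n \<noteq> 0"
  using c_pos[of n] by simp

lemma smul_eq: "smul H = (\<lambda>c f z. c * f z)"
  using rk by (simp add: reproducing_kernel_space_def)

lemma vecs_holomorphic: "f \<in> vecs H \<Longrightarrow> f holomorphic_on disc"
  and vecs_off: "f \<in> vecs H \<Longrightarrow> z \<notin> disc \<Longrightarrow> f z = 0"
  using rk by (auto simp: reproducing_kernel_space_def)

lemma complete:
  assumes "\<And>n. X n \<in> vecs H" "\<And>e. e > 0 \<Longrightarrow> \<exists>N. \<forall>p\<ge>N. \<forall>q\<ge>N. ip_norm H (X p - X q) < e"
  obtains x where "x \<in> vecs H" "(\<lambda>n. ip_norm H (X n - x)) \<longlonglongrightarrow> 0"
proof -
  have "hilbert_space H"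
    using rk by (simp add: reproducing_kernel_space_def)
  then have "(\<forall>n. X n \<in> vecs H) \<and> (\<forall>e>0. \<exists>N. \<forall>p\<ge>N. \<forall>q\<ge>N. ip_norm H (X p - X q) < e) \<longrightarrow>
      (\<exists>x\<in>vecs H. (\<lambda>n. ip_norm H (X n - x)) \<longlonglongrightarrow> 0)"
    unfolding hilbert_space_def by (elim conjE) (erule spec)
  moreover have "(\<forall>n. X n \<in> vecs H) \<and> (\<forall>e>0. \<exists>N. \<forall>p\<ge>N. \<forall>q\<ge>N. ip_norm H (X p - X q) < e)"
    using assms by (intro conjI allI impI)
  ultimately have "\<exists>x\<in>vecs H. (\<lambda>n. ip_norm H (X n - x)) \<longlonglongrightarrow> 0"
    by (rule mp)
  then show ?thesis
    using that by blast
qed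

definition ker where "ker w = (\<lambda>z. if z \<in> disc then K z w else 0)"

lemma ker_vecs: "w \<in> disc \<Longrightarrow> ker w \<in> vecs H"
  and ip_ker: "w \<in> disc \<Longrightarrow> f \<in> vecs H \<Longrightarrow> ip H f (ker w) = f w"
  using rk by (auto simp: reproducing_kernel_space_def ker_def)

text \<open>
  The monomial \<open>z\<^sup>n\<close> is, up to the factor \<open>c\<^sub>n\<close>, the norm limit as real \<open>t\<close> tends to 0 of the kernel
  functions \<open>K\<^sub>t\<close> with their Taylor polynomial in \<open>t\<close> of degree \<open>n - 1\<close> removed, divided by \<open>t\<^sup>n\<close>.
\<close>
lemma zpow_vecs_aux: "zpow n \<in> vecs H \<and> (\<forall>f\<in>vecs H. ip H f (zpow n) = taylor f n / of_real (c n))"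
proof (induction n rule: less_induct)
  case (less n)
  \<comment> \<open>The points are real, which removes conjugates, nonzero, and at most 1/2, which
    keeps \<open>2 * t i * t j\<close> in the disc.\<close>
  define t :: "nat \<Rightarrow> real" where "t i = inverse (of_nat (i + 2))" for i :: nat
  have t: "complex_of_real (t i) \<in> disc" "t i \<noteq> 0" for i
  proof -
    have "t i \<le> 1 / 2" "t i > 0"
      by (auto simp: t_def field_simps)
    then show "complex_of_real (t i) \<in> disc" "t i \<noteq> 0"
      by auto
  qed
  have t0: "(\<lambda>i. complex_of_real (t i)) \<longlonglongrightarrow> 0"
    using tendsto_of_real[OF LIMSEQ_ignore_initial_segment[OF lim_inverse_n, of 2]]
    unfolding t_def of_real_0 .
  define G where "G i = smul H (1 / of_real (t i) ^ n)
      (ker (t i) - (\<Sum>p<n. smul H (of_real (c p) * of_real (t i) ^ p) (zpow p)))" for i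
  have G: "G i \<in> vecs H" for i
    unfolding G_def using t less.IH by (intro smul_vecs diff_vecs ker_vecs sum_vecs) auto
  have ipG: "ip H f (G i) = (f (t i) - (\<Sum>p<n. taylor f p * of_real (t i) ^ p)) / of_real (t i) ^ n"
    if f: "f \<in> vecs H" for f i
  proof -
    have S: "(\<Sum>p<n. smul H (of_real (c p) * of_real (t i) ^ p) (zpow p)) \<in> vecs H"
      using less.IH by (intro sum_vecs smul_vecs) auto
    have "ip H f (\<Sum>p<n. smul H (of_real (c p) * of_real (t i) ^ p) (zpow p))
      = (\<Sum>p<n. taylor f p * of_real (t i) ^ p)"
      using f less.IH
      by (subst ip_sum_right) (auto simp: ip_smul_right intro!: sum.cong)
    then show ?thesis
      unfolding G_def using S t f by (simp add: ip_smul_right ip_diff_right ker_vecs ip_ker)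
  qed
  have lim_f: "(\<lambda>i. ip H f (G i)) \<longlonglongrightarrow> taylor f n" if f: "f \<in> vecs H" for f
    unfolding ipG[OF f]
  proof (rule filterlim_compose[OF power_series_remainder_tendsto[OF zero_less_one, of "taylor f" f]])
    show "filterlim (\<lambda>i. complex_of_real (t i)) (at 0) sequentially"
      using t t0 by (auto simp: filterlim_at)
  qed (use f in \<open>auto intro!: taylor_sums vecs_holomorphic\<close>)
  have ker_taylor: "taylor (ker w) p = of_real (c p) * cnj w ^ p" if "w \<in> disc" for w p
  proof (rule power_series_taylor(2))
    show "(\<lambda>p. of_real (c p) * cnj w ^ p * z ^ p) sums ker w z" if "z \<in> disc" for z
      using K_sums[OF that \<open>w \<in> disc\<close>] that by (simp add: ker_def power_mult_distrib mult_ac)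
  qed
  \<comment> \<open>On the disc the kernel depends on \<open>z * cnj w\<close> only, and the pair
    \<open>2 * z\<close>, \<open>1 / 2\<close> realises the product \<open>z\<close>. Hence all
    inner products of the \<open>G i\<close> are values of one function \<open>C\<close> with a
    limit at 0.\<close>
  define C where "C z = (K (2 * z) (1 / 2) - (\<Sum>p<n. of_real (c p) * z ^ p)) / z ^ n" for z
  have C0: "(C \<longlongrightarrow> of_real (c n)) (at 0)"
    unfolding C_def
  proof (rule power_series_remainder_tendsto[of "1 / 2"])
    show "(\<lambda>p. of_real (c p) * z ^ p) sums K (2 * z) (1 / 2)" if "norm z < 1 / 2" for z :: complex
      using K_sums[of "2 * z" "1 / 2"] that by (simp add: norm_mult)
  qed simp
  have ipGG: "ip H (G i) (G j) = C (of_real (t i * t j))" for i j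
  proof -
    have S: "(\<Sum>p<n. smul H (of_real (c p) * of_real (t i) ^ p) (zpow p)) \<in> vecs H"
      using less.IH by (intro sum_vecs smul_vecs) auto
    \<comment> \<open>A monomial of degree below \<open>n\<close> equals its own Taylor polynomial,
      so \<open>ipG\<close> gives 0 and only the kernel function in \<open>G i\<close>
      contributes.\<close>
    have "ip H (zpow p) (G j) = 0" if "p < n" for p
    proof -
      have "(\<Sum>q<n. taylor (zpow p) q * of_real (t j) ^ q) = of_real (t j) ^ p"
        using that by (simp add: taylor_zpow if_distrib[of "\<lambda>x. x * _"] cong: if_cong)
      then show ?thesis
        using that less.IH t[of j] by (simp add: ipG) (simp add: zpow_def)
    qed
    then have "ip H (\<Sum>p<n. smul H (of_real (c p) * of_real (t i) ^ p) (zpow p)) (G j) = 0"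
      using less.IH G by (subst ip_sum_left) (auto simp: ip_smul_left)
    then have "ip H (G i) (G j) = ip H (ker (t i)) (G j) / of_real (t i) ^ n"
      using S G t by (subst (1) G_def) (simp add: ip_smul_left ip_diff_left ker_vecs)
    also have "ip H (ker (t i)) (G j)
        = (K (t j) (t i) - (\<Sum>p<n. of_real (c p) * of_real (t i * t j) ^ p)) / of_real (t j) ^ n"
      using t[of i] t[of j]
      by (simp add: ipG ker_vecs ker_taylor power_mult_distrib mult.assoc) (simp add: ker_def)
    also have "\<dots> / of_real (t i) ^ n
        = (K (t j) (t i) - (\<Sum>p<n. of_real (c p) * of_real (t i * t j) ^ p)) / of_real (t i * t j) ^ n"
      by (simp add: power_mult_distrib mult.commute)
    also have "K (t j) (t i) = K (2 * of_real (t i * t j)) (1 / 2)"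
    proof (rule sums_unique2)
      show "(\<lambda>p. of_real (c p) * of_real (t i * t j) ^ p) sums K (t j) (t i)"
        using K_sums[OF t(1) t(1), of j i] by (simp add: mult.commute)
      have "t k \<le> 1 / 2" "t k > 0" for k
        by (auto simp: t_def field_simps)
      then have "t i * t j \<le> 1 / 2 * (1 / 2)" "t i > 0" "t j > 0"
        using mult_mono[of "t i" "1 / 2" "t j" "1 / 2"] by (simp_all add: less_imp_le)
      then show "(\<lambda>p. of_real (c p) * of_real (t i * t j) ^ p) sums K (2 * of_real (t i * t j)) (1 / 2)"
        using K_sums[of "2 * of_real (t i * t j)" "1 / 2"] by (simp add: norm_mult)
    qed
    finally show ?thesis
      by (simp add: C_def)
  qed
  \<comment> \<open>The squared norm of \<open>G i - G j\<close> is an alternating sum of four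
    values of \<open>C\<close>, each within \<open>e\<^sup>2 / 4\<close> of
    \<open>c n\<close>.\<close>
  have Cauchy: "\<exists>N. \<forall>i\<ge>N. \<forall>j\<ge>N. ip_norm H (G i - G j) < e" if e: "e > 0" for e
  proof -
    have "\<forall>\<^sub>F x in at 0. dist (C x) (of_real (c n)) < e\<^sup>2 / 4"
      using C0 e by (intro tendstoD) auto
    then have "\<exists>d>0. \<forall>x. x \<noteq> 0 \<and> norm x < d \<longrightarrow> norm (C x - of_real (c n)) < e\<^sup>2 / 4"
      by (simp add: eventually_at dist_norm)
    then obtain d where d: "d > 0" "\<And>x. x \<noteq> 0 \<Longrightarrow> norm x < d \<Longrightarrow> norm (C x - of_real (c n)) < e\<^sup>2 / 4"
      by blast
    have "\<forall>\<^sub>F i in sequentially. norm (complex_of_real (t i)) < min d 1"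
      using tendstoD[OF t0, of "min d 1"] d(1) by simp
    then have "\<exists>N. \<forall>i\<ge>N. \<bar>t i\<bar> < min d 1"
      by (simp add: eventually_sequentially)
    then obtain N where N: "\<And>i. i \<ge> N \<Longrightarrow> \<bar>t i\<bar> < min d 1"
      by blast
    have "ip_norm H (G i - G j) < e" if ij: "i \<ge> N" "j \<ge> N" for i j
    proof -
      have C: "\<bar>Re (C (of_real (t k * t l))) - c n\<bar> < e\<^sup>2 / 4" if "k \<ge> N" "l \<ge> N" for k l
      proof -
        have "\<bar>t k\<bar> * \<bar>t l\<bar> \<le> \<bar>t k\<bar> * 1"
          using N[OF that(2)] by (intro mult_left_mono) auto
        then have "norm (complex_of_real (t k * t l)) < d"
          using N[OF that(1)] by (simp add: abs_mult norm_mult)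
        then show ?thesis
          using order.strict_trans1[OF abs_Re_le_cmod d(2)[of "of_real (t k * t l)"]] t(2)[of k] t(2)[of l]
          by (simp del: of_real_mult)
      qed
      have "Re (ip H (G i - G j) (G i - G j))
        = Re (C (of_real (t i * t i))) - Re (C (of_real (t i * t j)))
          - Re (C (of_real (t j * t i))) + Re (C (of_real (t j * t j)))"
        by (simp only: ip_diff_left ip_diff_right ipGG G diff_vecs minus_complex.sel plus_complex.sel algebra_simps)
      also have "\<dots> < e\<^sup>2"
        using C[OF ij(1) ij(1)] C[OF ij] C[OF ij(2) ij(1)] C[OF ij(2) ij(2)]
        by (simp only: abs_less_iff) linarith
      finally have "sqrt (Re (ip H (G i - G j) (G i - G j))) < sqrt (e\<^sup>2)"
        by (rule real_sqrt_less_mono)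
      then show ?thesis
        using e by (simp add: ip_norm_def)
    qed
    then show ?thesis by blast
  qed
  obtain g where g: "g \<in> vecs H" "(\<lambda>i. ip_norm H (G i - g)) \<longlonglongrightarrow> 0"
    by (rule complete[OF G Cauchy])
  have gf: "ip H f g = taylor f n" if f: "f \<in> vecs H" for f
  proof -
    have "(\<lambda>i. cnj (ip H (G i) f)) \<longlonglongrightarrow> cnj (ip H g f)"
      by (intro tendsto_cnj tendsto_ip_left G g f)
    then have "(\<lambda>i. ip H f (G i)) \<longlonglongrightarrow> ip H f g"
      by (simp add: ip_commute[OF G f, symmetric] ip_commute[OF g(1) f, symmetric])
    then show ?thesis
      using lim_f[OF f] LIMSEQ_unique by blast
  qed
  \<comment> \<open>Pairing \<open>g\<close> with \<open>ker z\<close> gives \<open>g z\<close> as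
    the conjugate of the \<open>n\<close>-th Taylor coefficient of \<open>ker z\<close>, and this
    conjugate is \<open>c n * z ^ n\<close>.\<close>
  have "zpow n = smul H (1 / of_real (c n)) g"
  proof
    fix z
    show "zpow n z = smul H (1 / of_real (c n)) g z"
    proof (cases "z \<in> disc")
      case True
      have "g z = cnj (taylor (ker z) n)"
        using ip_ker[OF True g(1)] gf[OF ker_vecs[OF True]] ip_commute[OF ker_vecs[OF True] g(1)]
        by simp
      then show ?thesis
        using True c_pos[of n] by (simp add: zpow_def smul_eq ker_taylor)
    qed (use g(1) in \<open>simp add: zpow_def smul_eq vecs_off\<close>)
  qed
  then show ?case
    using g(1) by (auto simp: ip_smul_right gf)
qed

end

lemma taylor_eqI:
  assumes "f holomorphic_on disc" "g holomorphic_on disc" "\<And>n. taylor f n = taylor g n" "z \<in> disc"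
  shows "f z = g z"
  using taylor_sums[OF assms(1,4)] taylor_sums[OF assms(2,4)] assms(3) sums_unique2 by fastforce

context inner_product_space
begin

lemma ip_norm_minus_commute:
  assumes "x \<in> vecs H" "y \<in> vecs H"
  shows "ip_norm H (x - y) = ip_norm H (y - x)"
proof -
  have "y - x = smul H (-1) (x - y)"
    by simp
  then have "ip H (y - x) (y - x) = ip H (x - y) (x - y)"
    using ip_smul_left[of "x - y" "smul H (-1) (x - y)" "-1"] ip_smul_right[of "x - y" "x - y" "-1"] assms
    by simp
  then show ?thesis
    by (simp add: ip_norm_def)
qed

end

section \<open>Orthogonality of the monomials, and membership through Taylor coefficients\<close>

context power_series_rkhs
begin

lemma zpow_vecs [simp]: "zpow n \<in> vecs H"
  and ip_zpow: "f \<in> vecs H \<Longrightarrow> ip H f (zpow n) = taylor f n / of_real (c n)"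
  using zpow_vecs_aux by auto

lemma ip_zpow_zpow: "ip H (zpow m) (zpow n) = (if m = n then 1 / of_real (c n) else 0)"
  by (simp add: ip_zpow taylor_zpow)

definition psum where "psum a I = (\<Sum>n\<in>I. smul H (a n) (zpow n))" for a :: "nat \<Rightarrow> complex" and I

lemma psum_vecs [simp]: "psum a I \<in> vecs H"
  unfolding psum_def by (intro sum_vecs smul_vecs zpow_vecs)

lemma ip_psum_zpow: "finite I \<Longrightarrow> ip H (psum a I) (zpow n) = (if n \<in> I then a n / of_real (c n) else 0)"
  unfolding psum_def
  by (subst ip_sum_left) (auto simp: ip_smul_left ip_zpow_zpow if_distrib[of "\<lambda>x. _ * x"] cong: if_cong)

lemma ip_psum: "f \<in> vecs H \<Longrightarrow> ip H f (psum a I) = (\<Sum>n\<in>I. cnj (a n) * taylor f n / of_real (c n))"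
  unfolding psum_def by (subst ip_sum_right) (auto simp: ip_smul_right ip_zpow)

lemma ip_psum_self:
  assumes "finite I"
  shows "ip H (psum a I) (psum a I) = of_real (\<Sum>n\<in>I. (norm (a n))\<^sup>2 / c n)"
proof -
  have "ip H (psum a I) (psum a I) = (\<Sum>n\<in>I. cnj (a n) * ip H (psum a I) (zpow n))"
    by (subst (2) psum_def) (simp add: ip_sum_right ip_smul_right)
  also have "\<dots> = (\<Sum>n\<in>I. a n * cnj (a n) / of_real (c n))"
    using assms by (intro sum.cong) (auto simp: ip_psum_zpow)
  finally show ?thesis
    by (simp add: complex_norm_square[symmetric])
qed

lemma Bessel:
  assumes f: "f \<in> vecs H"
  shows "(\<Sum>n<N. (norm (taylor f n))\<^sup>2 / c n) \<le> Re (ip H f f)"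
proof -
  define D where "D = psum (taylor f) {..<N}"
  define S where "S = (\<Sum>n<N. (norm (taylor f n))\<^sup>2 / c n)"
  have D: "D \<in> vecs H"
    by (simp add: D_def)
  have fD: "ip H f D = of_real S"
    unfolding D_def S_def ip_psum[OF f] by (simp add: complex_norm_square[symmetric] mult.commute)
  have Df: "ip H D f = of_real S"
    using ip_commute[OF f D] fD by simp
  have DD: "ip H D D = of_real S"
    unfolding D_def S_def by (rule ip_psum_self) simp
  have "0 \<le> Re (ip H (f - D) (f - D))"
    using f D by (intro ip_self diff_vecs)
  also have "\<dots> = Re (ip H f f) - S"
    using f D by (simp add: ip_diff_left ip_diff_right fD Df DD)
  finally show ?thesis
    by (simp add: S_def)
qed

text \<open>The Taylor polynomials form a Cauchy sequence. Pairing with \<open>zpow n\<close> is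
  continuous, so their limit has the Taylor coefficients of \<open>f\<close>.\<close>

lemma vecsI:
  assumes holo: "f holomorphic_on disc" and off: "\<And>z. z \<notin> disc \<Longrightarrow> f z = 0"
    and summ: "summable (\<lambda>n. (norm (taylor f n))\<^sup>2 / c n)"
  shows "f \<in> vecs H"
proof -
  define X where "X N = psum (taylor f) {..<N}" for N
  have X: "X N \<in> vecs H" for N
    by (simp add: X_def)
  have Xdiff: "X p - X q = psum (taylor f) {q..<p}" if "q \<le> p" for p q
    using sum_diff_nat_ivl[of 0 q p] that by (simp add: X_def psum_def atLeast0LessThan)
  have Cauchy: "\<exists>N. \<forall>p\<ge>N. \<forall>q\<ge>N. ip_norm H (X p - X q) < e" if e: "e > 0" for e
  proof -
    obtain N where N: "\<And>q p. q \<ge> N \<Longrightarrow> norm (\<Sum>n=q..<p. (norm (taylor f n))\<^sup>2 / c n) < e\<^sup>2"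
      using summ e unfolding summable_Cauchy by (meson zero_less_power)
    have less: "ip_norm H (X p - X q) < e" if "q \<ge> N" "q \<le> p" for p q
    proof -
      have "ip_norm H (X p - X q) = sqrt (\<Sum>n=q..<p. (norm (taylor f n))\<^sup>2 / c n)"
        unfolding ip_norm_def Xdiff[OF that(2)] ip_psum_self[OF finite_atLeastLessThan] by simp
      also have "\<dots> < sqrt (e\<^sup>2)"
        using N[OF that(1), of p] by (intro real_sqrt_less_mono) simp
      finally show ?thesis
        using e by simp
    qed
    have "ip_norm H (X p - X q) < e" if "p \<ge> N" "q \<ge> N" for p q
      using less[of q p] less[of p q] that ip_norm_minus_commute[OF X X, of p q]
      by (cases "q \<le> p") auto
    then show ?thesis by blast
  qed
  obtain x where x: "x \<in> vecs H" "(\<lambda>n. ip_norm H (X n - x)) \<longlonglongrightarrow> 0"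
    by (rule complete[OF X Cauchy])
  have "taylor x n = taylor f n" for n
  proof -
    have "(\<lambda>N. ip H (X N) (zpow n)) \<longlonglongrightarrow> ip H x (zpow n)"
      by (intro tendsto_ip_left X x zpow_vecs)
    moreover have "\<forall>\<^sub>F N in sequentially. ip H (X N) (zpow n) = taylor f n / of_real (c n)"
      using eventually_gt_at_top[of n] by eventually_elim (simp add: X_def ip_psum_zpow)
    ultimately have "(\<lambda>N. taylor f n / of_real (c n)) \<longlonglongrightarrow> ip H x (zpow n)"
      by (rule Lim_transform_eventually)
    then show ?thesis
      by (simp add: LIMSEQ_const_iff ip_zpow x)
  qed
  then have "f z = x z" for z
    using taylor_eqI[of f x z] off[of z] vecs_off[OF x(1), of z] vecs_holomorphic[OF x(1)] holo
    by (cases "z \<in> disc") auto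
  then have "f = x" ..
  then show ?thesis
    using x by simp
qed

lemma vecs_iff:
  "f \<in> vecs H \<longleftrightarrow> f holomorphic_on disc \<and> (\<forall>z. z \<notin> disc \<longrightarrow> f z = 0) \<and>
    summable (\<lambda>n. (norm (taylor f n))\<^sup>2 / c n)"
proof
  assume f: "f \<in> vecs H"
  have "summable (\<lambda>n. (norm (taylor f n))\<^sup>2 / c n)"
  proof (rule bounded_imp_summable)
    show "(norm (taylor f n))\<^sup>2 / c n \<ge> 0" for n
      using c_pos[of n] by simp
    show "(\<Sum>n\<le>N. (norm (taylor f n))\<^sup>2 / c n) \<le> Re (ip H f f)" for N
      using Bessel[OF f, of "Suc N"] by (simp add: lessThan_Suc_atMost)
  qed
  then show "f holomorphic_on disc \<and> (\<forall>z. z \<notin> disc \<longrightarrow> f z = 0) \<and>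
      summable (\<lambda>n. (norm (taylor f n))\<^sup>2 / c n)"
    using f vecs_holomorphic vecs_off by blast
qed (blast intro: vecsI)

end

section \<open>The weighted Bergman spaces\<close>

text \<open>The binomial series with exponent \<open>- 2 * \<alpha>\<close>; the sign of the
  binomial coefficient cancels the sign in the powers of \<open>- (z * cnj w)\<close>.\<close>

lemma disc_kernel_sums:
  assumes "z \<in> disc" "w \<in> disc"
  shows "(\<lambda>n. of_real (pochhammer (2 * \<alpha>) n / fact n) * (z * cnj w) ^ n) sums disc_kernel \<alpha> z w"
proof -
  have "norm (- (z * cnj w)) < 1"
    using assms mult_strict_mono'[of "norm z" 1 "norm w" 1] by (simp add: norm_mult)
  from gen_binomial_complex[OF this, of "of_real (- 2 * \<alpha>)"]
  have "(\<lambda>n. (of_real (- 2 * \<alpha>) gchoose n) * (- (z * cnj w)) ^ n) sums disc_kernel \<alpha> z w"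
    by (simp add: disc_kernel_def)
  moreover have "(of_real (- 2 * \<alpha>) gchoose n) * (- (z * cnj w)) ^ n
      = of_real (pochhammer (2 * \<alpha>) n / fact n) * (z * cnj w) ^ n" for n
  proof -
    have "complex_of_real (- 2 * \<alpha>) gchoose n = (- 1) ^ n * of_real (pochhammer (2 * \<alpha>) n / fact n)"
      unfolding gbinomial_pochhammer by (simp flip: pochhammer_of_real)
    moreover have "(- (z * cnj w)) ^ n = (- 1) ^ n * (z * cnj w) ^ n"
      by (rule power_minus)
    moreover have "(- 1) ^ n * (- 1) ^ n = (1::complex)"
      by (simp flip: power_mult_distrib)
    moreover have "(e * p) * (e * q) = (e * e) * (p * q)" for e p q :: complex
      by (simp only: mult_ac)
    ultimately show ?thesis
      by (simp only: mult_1)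
  qed
  ultimately show ?thesis
    by simp
qed

lemma power_series_rkhs_A_space:
  assumes "\<alpha> > 0"
  shows "power_series_rkhs (A_space \<alpha>) (\<lambda>n. pochhammer (2 * \<alpha>) n / fact n) (disc_kernel \<alpha>)"
  using assms A_space_reproducing_kernel disc_kernel_sums by unfold_locales (auto simp: pochhammer_pos)

text \<open>The squared norm of \<open>zpow n\<close> in \<open>A_space \<alpha>\<close>, the
  reciprocal of the kernel coefficient.\<close>

definition weight :: "real \<Rightarrow> nat \<Rightarrow> real" where
  "weight \<alpha> n = fact n / pochhammer (2 * \<alpha>) n"

lemma weight_pos: "\<alpha> > 0 \<Longrightarrow> weight \<alpha> n > 0"
  by (simp add: weight_def pochhammer_pos)

lemma A_space_iff:
  assumes "\<alpha> > 0"
  shows "f \<in> vecs (A_space \<alpha>) \<longleftrightarrow> f holomorphic_on disc \<and> (\<forall>z. z \<notin> disc \<longrightarrow> f z = 0) \<and>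
    summable (\<lambda>n. (norm (taylor f n))\<^sup>2 * weight \<alpha> n)"
proof -
  interpret power_series_rkhs "A_space \<alpha>" "\<lambda>n. pochhammer (2 * \<alpha>) n / fact n" "disc_kernel \<alpha>"
    by (rule power_series_rkhs_A_space[OF assms])
  show ?thesis
    by (simp add: vecs_iff weight_def)
qed

lemma A_space_zpow:
  assumes "\<alpha> > 0"
  shows "zpow n \<in> vecs (A_space \<alpha>)"
    and "f \<in> vecs (A_space \<alpha>) \<Longrightarrow> ip (A_space \<alpha>) f (zpow n) = taylor f n * of_real (weight \<alpha> n)"
proof -
  interpret power_series_rkhs "A_space \<alpha>" "\<lambda>n. pochhammer (2 * \<alpha>) n / fact n" "disc_kernel \<alpha>"
    by (rule power_series_rkhs_A_space[OF assms])
  show "zpow n \<in> vecs (A_space \<alpha>)"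
    by simp
  show "ip (A_space \<alpha>) f (zpow n) = taylor f n * of_real (weight \<alpha> n)" if "f \<in> vecs (A_space \<alpha>)"
    using that by (simp add: ip_zpow weight_def)
qed

text \<open>Membership passes from \<open>f\<close> to \<open>g\<close> by comparison of weighted
  coefficients; the offsets \<open>k\<close> and \<open>l\<close> allow for operators that raise or
  lower the degree.\<close>

lemma A_space_transferI:
  assumes f: "f \<in> vecs (A_space \<alpha>)" and \<alpha>: "\<alpha> > 0" "\<beta> > 0"
    and g: "\<And>z. z \<in> disc \<Longrightarrow> (\<lambda>n. b n * z ^ n) sums g z" "\<And>z. z \<notin> disc \<Longrightarrow> g z = 0"
    and le: "\<And>n. (norm (b (n + k)))\<^sup>2 * weight \<beta> (n + k) \<le> C * ((norm (taylor f (n + l)))\<^sup>2 * weight \<alpha> (n + l))"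
  shows "g \<in> vecs (A_space \<beta>)"
proof -
  have "summable (\<lambda>n. (norm (taylor f (n + l)))\<^sup>2 * weight \<alpha> (n + l))"
    using f \<alpha> by (subst summable_iff_shift) (simp add: A_space_iff)
  then have "summable (\<lambda>n. C * ((norm (taylor f (n + l)))\<^sup>2 * weight \<alpha> (n + l)))"
    by (rule summable_mult)
  then have "summable (\<lambda>n. (norm (b (n + k)))\<^sup>2 * weight \<beta> (n + k))"
    by (rule summable_comparison_test'[of _ 0]) (use le weight_pos[OF \<alpha>(2)] in \<open>simp add: less_imp_le\<close>)
  then have "summable (\<lambda>n. (norm (b n))\<^sup>2 * weight \<beta> n)"
    by (simp only: summable_iff_shift[of "\<lambda>n. (norm (b n))\<^sup>2 * weight \<beta> n" k])
  then show ?thesis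
    using g power_series_taylor[of b g] \<alpha> by (simp add: A_space_iff)
qed

lemma weight_Suc: "\<alpha> > 0 \<Longrightarrow> weight \<alpha> (Suc n) = weight \<alpha> n * ((n + 1) / (2 * \<alpha> + n))"
  by (simp add: weight_def pochhammer_Suc field_simps)

text \<open>These are the bounds behind multiplication by z, division by z and differentiation, in
  this order; the last one raises \<open>\<alpha>\<close> by 1.\<close>

lemma weight_Suc_le:
  assumes "\<alpha> > 0"
  shows "weight \<alpha> (Suc n) \<le> (1 + 1 / (2 * \<alpha>)) * weight \<alpha> n"
    and "weight \<alpha> n \<le> (1 + 2 * \<alpha>) * weight \<alpha> (Suc n)"
    and "(real n + 1)\<^sup>2 * weight (\<alpha> + 1) n \<le> 2 * \<alpha> * (2 * \<alpha> + 1) * weight \<alpha> (Suc n)"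
proof -
  have "(n + 1) / (2 * \<alpha> + n) \<le> 1 + 1 / (2 * \<alpha>)"
    using assms by (simp add: field_simps)
  then show "weight \<alpha> (Suc n) \<le> (1 + 1 / (2 * \<alpha>)) * weight \<alpha> n"
    using weight_pos[OF assms, of n] mult_left_mono[of "(n + 1) / (2 * \<alpha> + n)" "1 + 1 / (2 * \<alpha>)" "weight \<alpha> n"]
    by (simp add: weight_Suc[OF assms] mult.commute add.commute)
  have "1 \<le> (1 + 2 * \<alpha>) * ((n + 1) / (2 * \<alpha> + n))"
    using assms by (simp add: field_simps)
  then show "weight \<alpha> n \<le> (1 + 2 * \<alpha>) * weight \<alpha> (Suc n)"
    using weight_pos[OF assms, of n]
      mult_left_mono[of 1 "(1 + 2 * \<alpha>) * ((n + 1) / (2 * \<alpha> + n))" "weight \<alpha> n"]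
    by (simp add: weight_Suc[OF assms] mult_ac add.commute)
  \<comment> \<open>Splitting \<open>pochhammer (2 * \<alpha>) (n + 2)\<close> after its first two
    factors and before its last one relates the weights for \<open>\<alpha>\<close> and
    \<open>\<alpha> + 1\<close>.\<close>
  have p: "pochhammer (2 * \<alpha>) (n + 2) = 2 * \<alpha> * (2 * \<alpha> + 1) * pochhammer (2 * \<alpha> + 2) n"
    by (simp add: pochhammer_rec add.assoc numeral_2_eq_2)
  have "2 * \<alpha> * (2 * \<alpha> + 1) * weight \<alpha> (Suc n)
      = (real n + 1)\<^sup>2 * weight (\<alpha> + 1) n * ((2 * \<alpha> + n + 1) / (n + 1))"
  proof -
    have "pochhammer (2 * \<alpha>) (Suc n) * (2 * \<alpha> + n + 1) = 2 * \<alpha> * (2 * \<alpha> + 1) * pochhammer (2 * \<alpha> + 2) n"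
      unfolding p[symmetric] by (simp add: pochhammer_Suc add.assoc)
    moreover have "pochhammer (2 * \<alpha>) (Suc n) > 0" "pochhammer (2 * \<alpha> + 2) n > 0"
      using assms by (auto intro: pochhammer_pos)
    ultimately have *: "2 * \<alpha> * (2 * \<alpha> + 1) / pochhammer (2 * \<alpha>) (Suc n)
        = (2 * \<alpha> + n + 1) / pochhammer (2 * \<alpha> + 2) n"
      by (subst frac_eq_eq) (auto simp: mult_ac)
    have "2 * \<alpha> * (2 * \<alpha> + 1) * weight \<alpha> (Suc n)
        = fact (Suc n) * (2 * \<alpha> * (2 * \<alpha> + 1) / pochhammer (2 * \<alpha>) (Suc n))"
      by (simp add: weight_def)
    also have "\<dots> = (real n + 1)\<^sup>2 * weight (\<alpha> + 1) n * ((2 * \<alpha> + n + 1) / (n + 1))"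
    proof -
      have "c * f * (x / q) = c\<^sup>2 * (f / q) * (x / c)" if "c \<noteq> 0" for c f x q :: real
        using that by (simp add: power2_eq_square)
      moreover have "weight (\<alpha> + 1) n = fact n / pochhammer (2 * \<alpha> + 2) n"
        by (simp add: weight_def distrib_left)
      moreover have "fact (Suc n) = (real n + 1) * fact n"
        by (simp add: add.commute)
      ultimately show ?thesis
        unfolding * of_nat_add of_nat_1 by (metis of_nat_Suc of_nat_neq_0 add.commute)
    qed
    finally show ?thesis .
  qed
  also have "\<dots> \<ge> (real n + 1)\<^sup>2 * weight (\<alpha> + 1) n * 1"
    using assms weight_pos[of "\<alpha> + 1" n] by (intro mult_left_mono) (auto simp: field_simps)
  finally show "(real n + 1)\<^sup>2 * weight (\<alpha> + 1) n \<le> 2 * \<alpha> * (2 * \<alpha> + 1) * weight \<alpha> (Suc n)"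
    by simp
qed

section \<open>Multiplication by z, division by z and differentiation on the scalar spaces\<close>

lemma A_space_mult_z:
  assumes \<alpha>: "\<alpha> > 0" and f: "f \<in> vecs (A_space \<alpha>)"
  shows "(\<lambda>z. z * f z) \<in> vecs (A_space \<alpha>)"
proof (rule A_space_transferI[OF f \<alpha> \<alpha>])
  define b where "b n = (case n of 0 \<Rightarrow> 0 | Suc n \<Rightarrow> taylor f n)" for n
  show "(\<lambda>n. b n * z ^ n) sums (z * f z)" if "z \<in> disc" for z
  proof -
    have "(\<lambda>n. b (Suc n) * z ^ Suc n) sums (z * f z)"
      using sums_mult[OF taylor_sums[of f z], of z] that f \<alpha> by (simp add: A_space_iff b_def mult_ac)
    then show ?thesis
      by (subst (asm) sums_Suc_iff) (simp add: b_def)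
  qed
  show "z * f z = 0" if "z \<notin> disc" for z
    using f \<alpha> that by (simp add: A_space_iff)
  show "(norm (b (n + 1)))\<^sup>2 * weight \<alpha> (n + 1)
      \<le> (1 + 1 / (2 * \<alpha>)) * ((norm (taylor f (n + 0)))\<^sup>2 * weight \<alpha> (n + 0))" for n
    using mult_left_mono[OF weight_Suc_le(1)[OF \<alpha>, of n], of "(norm (taylor f n))\<^sup>2"]
    by (simp add: b_def mult_ac)
qed

lemma A_space_div_z:
  assumes \<alpha>: "\<alpha> > 0" and f: "f \<in> vecs (A_space \<alpha>)" and f0: "f 0 = 0"
  obtains g where "g \<in> vecs (A_space \<alpha>)" "\<And>z. f z = z * g z"
proof -
  define b where "b n = taylor f (Suc n)" for n
  have f': "f holomorphic_on disc" "\<And>z. z \<notin> disc \<Longrightarrow> f z = 0"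
    using f \<alpha> by (auto simp: A_space_iff)
  have z: "(\<lambda>n. b n * z ^ Suc n) sums f z" if "z \<in> disc" for z
    using taylor_sums[OF f'(1) that] f0 unfolding b_def
    by (subst sums_Suc_iff) (simp add: taylor_def)
  define g where "g z = (if z \<in> disc then if z = 0 then b 0 else f z / z else 0)" for z
  show ?thesis
  proof
    show "f z = z * g z" for z
      using f0 f'(2)[of z] by (simp add: g_def)
    show "g \<in> vecs (A_space \<alpha>)"
    proof (rule A_space_transferI[OF f \<alpha> \<alpha>])
      show "(\<lambda>n. b n * z ^ n) sums g z" if "z \<in> disc" for z
      proof (cases "z = 0")
        case True
        then show ?thesis
          using powser_sums_zero[of b] by (simp add: g_def)
      next
        case False
        then show ?thesis
          using sums_divide[OF z[OF that], of z] that by (simp add: g_def)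
      qed
      show "g z = 0" if "z \<notin> disc" for z
        using that by (simp add: g_def)
      show "(norm (b (n + 0)))\<^sup>2 * weight \<alpha> (n + 0)
          \<le> (1 + 2 * \<alpha>) * ((norm (taylor f (n + 1)))\<^sup>2 * weight \<alpha> (n + 1))" for n
        using mult_left_mono[OF weight_Suc_le(2)[OF \<alpha>, of n], of "(norm (taylor f (Suc n)))\<^sup>2"]
        by (simp add: b_def mult_ac)
    qed
  qed
qed

text \<open>Derivatives of a total function are not controlled off the disc, so they are set to 0
  there, as membership in \<open>A_space\<close> demands.\<close>

definition dder :: "nat \<Rightarrow> (complex \<Rightarrow> complex) \<Rightarrow> complex \<Rightarrow> complex" where
  "dder n f z = (if z \<in> disc then (deriv ^^ n) f z else 0)"

lemma A_space_dder1:
  assumes \<alpha>: "\<alpha> > 0" and f: "f \<in> vecs (A_space \<alpha>)"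
  shows "dder 1 f \<in> vecs (A_space (\<alpha> + 1))"
proof (rule A_space_transferI[OF f \<alpha>])
  have f': "f holomorphic_on disc"
    using f \<alpha> by (auto simp: A_space_iff)
  define b where "b n = of_nat (Suc n) * taylor f (Suc n)" for n
  have "b n = taylor (deriv f) n" for n
    by (simp add: b_def taylor_def funpow_swap1 field_simps del: of_nat_Suc)
  then show "(\<lambda>n. b n * z ^ n) sums dder 1 f z" if "z \<in> disc" for z
    using taylor_sums[OF holomorphic_deriv[OF f'] that] that by (simp add: dder_def)
  show "dder 1 f z = 0" if "z \<notin> disc" for z
    using that by (simp add: dder_def)
  show "(norm (b (n + 0)))\<^sup>2 * weight (\<alpha> + 1) (n + 0)
      \<le> (2 * \<alpha> * (2 * \<alpha> + 1)) * ((norm (taylor f (n + 1)))\<^sup>2 * weight \<alpha> (n + 1))" for n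
  proof -
    have "norm (b n) = (real n + 1) * norm (taylor f (Suc n))"
      unfolding b_def norm_mult norm_of_nat by simp
    then show ?thesis
      using mult_left_mono[OF weight_Suc_le(3)[OF \<alpha>, of n], of "(norm (taylor f (Suc n)))\<^sup>2"]
      by (simp add: power_mult_distrib mult_ac)
  qed
qed (use \<alpha> in simp)

lemma dder_Suc: "f holomorphic_on disc \<Longrightarrow> dder (Suc n) f = dder 1 (dder n f)"
proof
  fix z assume f: "f holomorphic_on disc"
  show "dder (Suc n) f z = dder 1 (dder n f) z"
  proof (cases "z \<in> disc")
    case True
    then have "\<forall>\<^sub>F w in nhds z. w \<in> disc"
      by (intro eventually_nhds_in_open) auto
    then have "\<forall>\<^sub>F w in nhds z. dder n f w = (deriv ^^ n) f w"
      by eventually_elim (simp add: dder_def)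
    then show ?thesis
      using True deriv_cong_ev[of "dder n f" "(deriv ^^ n) f" z z] by (simp add: dder_def)
  qed (simp add: dder_def)
qed

text \<open>One derivative raises the index by 1, exactly the step from
  \<open>lam_shift lam m j\<close> to \<open>lam_shift lam m (j + 1)\<close>. Hence component
  \<open>l\<close> of every \<open>Gam\<close> image lies in the scalar space of index
  \<open>lam_shift lam m l\<close>.\<close>

lemma A_space_dder:
  assumes \<alpha>: "\<alpha> > 0" and f: "f \<in> vecs (A_space \<alpha>)"
  shows "dder n f \<in> vecs (A_space (\<alpha> + n))"
proof (induction n)
  case 0
  have "dder 0 f = f"
    using f \<alpha> by (auto simp: dder_def A_space_iff)
  then show ?case
    using f by simp
next
  case (Suc n)
  have "f holomorphic_on disc"
    using f \<alpha> by (simp add: A_space_iff)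
  from dder_Suc[OF this, of n] show ?case
    using A_space_dder1[OF _ Suc] \<alpha> by (simp add: add_ac)
qed

section \<open>The vector-valued spaces\<close>

lemma inner_product_space_A:
  assumes "\<alpha> > 0"
  shows "inner_product_space (A_space \<alpha>)"
proof -
  interpret power_series_rkhs "A_space \<alpha>" "\<lambda>n. pochhammer (2 * \<alpha>) n / fact n" "disc_kernel \<alpha>"
    by (rule power_series_rkhs_A_space[OF assms])
  show ?thesis
    by (rule inner_product_space_axioms)
qed

lemma A_space_smul: "\<alpha> > 0 \<Longrightarrow> smul (A_space \<alpha>) = (\<lambda>c f z. c * f z)"
  using A_space_reproducing_kernel by (simp add: reproducing_kernel_space_def)

lemma A_space_holomorphic: "\<alpha> > 0 \<Longrightarrow> f \<in> vecs (A_space \<alpha>) \<Longrightarrow> f holomorphic_on disc"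
  and A_space_off: "\<alpha> > 0 \<Longrightarrow> f \<in> vecs (A_space \<alpha>) \<Longrightarrow> z \<notin> disc \<Longrightarrow> f z = 0"
  by (auto simp: A_space_iff)

lemma dder_0: "\<alpha> > 0 \<Longrightarrow> f \<in> vecs (A_space \<alpha>) \<Longrightarrow> dder 0 f = f"
  by (auto simp: dder_def A_space_off)

lemma dder_add: "f holomorphic_on disc \<Longrightarrow> g holomorphic_on disc \<Longrightarrow> dder n (f + g) z = dder n f z + dder n g z"
  using higher_deriv_add[of f disc g z n] by (auto simp: dder_def plus_fun_def)

lemma dder_cmult: "f holomorphic_on disc \<Longrightarrow> dder n (\<lambda>z. c * f z) z = c * dder n f z"
  using higher_deriv_cmult[of f disc z n c] by (auto simp: dder_def)

lemma dder_zero [simp]: "dder n (\<lambda>z. 0) z = 0"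
  using dder_cmult[of "\<lambda>z. 0" n 0 z] by simp

lemma dder_zpow:
  "dder k (zpow n) z = (if k \<le> n then of_real (fact n / fact (n - k)) * zpow (n - k) z else 0)"
proof (cases "z \<in> disc")
  case True
  have "(deriv ^^ k) (zpow n) z = (deriv ^^ k) (\<lambda>w. w ^ n) z"
  proof (rule higher_deriv_transform_within_open)
    show "zpow n holomorphic_on disc"
      by (rule holomorphic_transform[of "\<lambda>w. w ^ n"]) (auto intro!: holomorphic_intros simp: zpow_def)
  qed (use True in \<open>auto intro!: holomorphic_intros simp: zpow_def\<close>)
  also have "\<dots> = pochhammer (of_nat (Suc n - k)) k * z ^ (n - k)"
    using higher_deriv_power[of k 0 n z] by simp
  \<comment> \<open>For \<open>k > n\<close> the truncated difference \<open>Suc n - k\<close> is 0,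
    and the Pochhammer symbol of 0 vanishes for positive \<open>k\<close>.\<close>
  also have "pochhammer (of_nat (Suc n - k)) k = (if k \<le> n then of_real (fact n / fact (n - k)) else (0::complex))"
  proof (cases "k \<le> n")
    case True
    then have "(fact n :: complex) = fact (n - k) * pochhammer (of_nat (Suc n - k)) k"
      using pochhammer_product'[of "1::complex" "n - k" k] by (simp add: pochhammer_fact Suc_diff_le)
    then show ?thesis
      using True by simp
  qed (auto simp: pochhammer_0_left)
  finally have "(deriv ^^ k) (zpow n) z
      = (if k \<le> n then of_real (fact n / fact (n - k)) else 0) * z ^ (n - k)" .
  moreover have "zpow (n - k) z = z ^ (n - k)"
    using True by (simp add: zpow_def)
  ultimately show ?thesis
    using True by (simp add: dder_def)
qed (simp add: dder_def zpow_def)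

text \<open>As a matrix in \<open>l\<close> and \<open>j\<close> the coefficients of the maps
  \<open>Gam\<close> are lower triangular with unit diagonal, which permits inversion by forward
  substitution.\<close>

definition gcoef :: "real \<Rightarrow> nat \<Rightarrow> nat \<Rightarrow> nat \<Rightarrow> real" where
  "gcoef lam m l j = real (l choose j) / pochhammer (2 * lam_shift lam m j) (l - j)"

lemma gcoef_eq_0 [simp]: "l < j \<Longrightarrow> gcoef lam m l j = 0"
  and gcoef_same [simp]: "gcoef lam m j j = 1"
  by (simp_all add: gcoef_def)

lemma Gam_eq: "Gam lam m j f z l = (if l \<le> m then of_real (gcoef lam m l j) * dder (l - j) f z else 0)"
  by (auto simp: Gam_def gcoef_def dder_def not_le pochhammer_of_real[symmetric])

lemma sum_gcoef:
  fixes m :: nat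
  assumes "l \<le> m"
  shows "(\<Sum>j\<le>m. of_real (gcoef lam m l j) * g j) = (\<Sum>j\<le>l. of_real (gcoef lam m l j) * g j :: complex)"
  by (rule sum.mono_neutral_right) (use assms in auto)

lemma sum_fun_apply: "(\<Sum>i\<in>I. F i) z = (\<Sum>i\<in>I. F i z)" for F :: "'i \<Rightarrow> 'a \<Rightarrow> 'b::comm_monoid_add"
  using sum_comp_morphism[of "\<lambda>F. F z" F I] by (simp add: comp_def)

text \<open>Forward substitution: the functions \<open>f\<^sub>j\<close> with \<open>F = \<Sum>\<^sub>j \<Gamma>\<^sub>j f\<^sub>j\<close>.\<close>
fun unGam :: "real \<Rightarrow> nat \<Rightarrow> (complex \<Rightarrow> nat \<Rightarrow> complex) \<Rightarrow> nat \<Rightarrow> complex \<Rightarrow> complex" where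
  "unGam lam m F l = (\<lambda>z. F z l - (\<Sum>j<l. of_real (gcoef lam m l j) * dder (l - j) (unGam lam m F j) z))"

declare unGam.simps [simp del]

section \<open>Components and inner product of the vector-valued space\<close>

locale bold_space =
  fixes m :: nat and lam :: real and \<mu> :: "nat \<Rightarrow> real"
  assumes lam: "lam > real m / 2" and \<mu>_pos: "j \<le> m \<Longrightarrow> \<mu> j > 0" and \<mu>_0: "\<mu> 0 = 1"
begin

abbreviation "ls \<equiv> lam_shift lam m"
abbreviation "A j \<equiv> A_space (ls j)"
abbreviation "gc \<equiv> gcoef lam m"
abbreviation "\<Gamma> \<equiv> Gam lam m"
abbreviation "H \<equiv> bold_A_space m lam \<mu>"
abbreviation "cmp \<equiv> Gam_components lam m"

lemma ls_pos [simp]: "ls j > 0"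
  using lam by (simp add: lam_shift_def)

lemma ls_add: "ls (j + k) = ls j + k"
  by (simp add: lam_shift_def field_simps)

lemma ls_diff: "j \<le> l \<Longrightarrow> ls j + real (l - j) = ls l"
  using ls_add[of j "l - j"] by simp

lemma ips_A: "inner_product_space (A j)"
  by (simp add: inner_product_space_A)

lemmas A_ops [simp] = inner_product_space.add_vecs[OF ips_A] inner_product_space.smul_vecs[OF ips_A]

lemma A_cmult [simp]: "f \<in> vecs (A j) \<Longrightarrow> (\<lambda>z. c * f z) \<in> vecs (A j)"
  using inner_product_space.smul_vecs[OF ips_A, of f j c] by (simp add: A_space_smul)

lemma vecs_H: "vecs H = {\<Sum>j\<le>m. \<Gamma> j (f j) |f. \<forall>j\<le>m. f j \<in> vecs (A j)}"
  and smul_H: "smul H = (\<lambda>c F z l. c * F z l)"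
  and ip_H: "ip H F G = (\<Sum>j\<le>m. of_real (1 / (\<mu> j)\<^sup>2) * ip (A j) (cmp F j) (cmp G j))"
  by (simp_all add: bold_A_space_def)

lemma cmp_sum:
  assumes "\<And>j. j \<le> m \<Longrightarrow> f j \<in> vecs (A j)" "j \<le> m"
  shows "cmp (\<Sum>j\<le>m. \<Gamma> j (f j)) j = f j"
proof -
  have "cmp (\<Sum>j\<le>m. \<Gamma> j (restrict f {..m} j)) = restrict f {..m}"
    by (rule Gam_components_sum[OF lam]) (use assms in auto)
  then show ?thesis
    using assms by simp
qed

lemma sum_vecs_H: "(\<And>j. j \<le> m \<Longrightarrow> f j \<in> vecs (A j)) \<Longrightarrow> (\<Sum>j\<le>m. \<Gamma> j (f j)) \<in> vecs H"
  unfolding vecs_H by blast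

lemma
  assumes "F \<in> vecs H"
  shows cmp_vecs: "j \<le> m \<Longrightarrow> cmp F j \<in> vecs (A j)" and sum_cmp: "(\<Sum>j\<le>m. \<Gamma> j (cmp F j)) = F"
proof -
  obtain f where f: "\<And>j. j \<le> m \<Longrightarrow> f j \<in> vecs (A j)" "F = (\<Sum>j\<le>m. \<Gamma> j (f j))"
    using assms by (auto simp: vecs_H)
  then show "j \<le> m \<Longrightarrow> cmp F j \<in> vecs (A j)"
    using cmp_sum[of f j] by simp
  show "(\<Sum>j\<le>m. \<Gamma> j (cmp F j)) = F"
    using f cmp_sum[of f] by (auto intro!: sum.cong)
qed

lemma H_apply: "F \<in> vecs H \<Longrightarrow> F z l = (if l \<le> m then \<Sum>j\<le>m. of_real (gc l j) * dder (l - j) (cmp F j) z else 0)"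
  using arg_cong[OF sum_cmp[of F], of "\<lambda>F. F z l"] by (cases "l \<le> m") (simp_all add: sum_fun_apply Gam_eq)

lemma sum_\<Gamma>_add:
  assumes "\<And>j. j \<le> m \<Longrightarrow> f j \<in> vecs (A j)" "\<And>j. j \<le> m \<Longrightarrow> g j \<in> vecs (A j)"
  shows "(\<Sum>j\<le>m. \<Gamma> j (f j + g j)) = (\<Sum>j\<le>m. \<Gamma> j (f j)) + (\<Sum>j\<le>m. \<Gamma> j (g j))"
proof -
  have "\<Gamma> j (f j + g j) = \<Gamma> j (f j) + \<Gamma> j (g j)" if "j \<le> m" for j
    using assms[OF that] A_space_holomorphic[OF ls_pos]
    by (auto simp: fun_eq_iff Gam_eq dder_add algebra_simps)
  then show ?thesis
    by (simp add: sum.distrib)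
qed

lemma sum_\<Gamma>_cmult:
  assumes "\<And>j. j \<le> m \<Longrightarrow> f j \<in> vecs (A j)"
  shows "(\<Sum>j\<le>m. \<Gamma> j (\<lambda>z. c * f j z)) = (\<lambda>z l. c * (\<Sum>j\<le>m. \<Gamma> j (f j)) z l)"
proof -
  have "\<Gamma> j (\<lambda>z. c * f j z) z l = c * \<Gamma> j (f j) z l" if "j \<le> m" for j z l
    using assms[OF that] A_space_holomorphic[OF ls_pos]
    by (auto simp: Gam_eq dder_cmult)
  then show ?thesis
    by (simp add: fun_eq_iff sum_fun_apply sum_distrib_left)
qed

lemma cmp_add:
  assumes F: "F \<in> vecs H" and G: "G \<in> vecs H"
  shows "F + G \<in> vecs H" "j \<le> m \<Longrightarrow> cmp (F + G) j = cmp F j + cmp G j"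
proof -
  have eq: "F + G = (\<Sum>j\<le>m. \<Gamma> j (cmp F j + cmp G j))"
    using sum_\<Gamma>_add[OF cmp_vecs[OF F] cmp_vecs[OF G]] by (simp add: sum_cmp F G)
  show "F + G \<in> vecs H"
    unfolding eq by (rule sum_vecs_H) (simp add: cmp_vecs F G)
  show "j \<le> m \<Longrightarrow> cmp (F + G) j = cmp F j + cmp G j"
    unfolding eq by (rule cmp_sum) (auto simp: cmp_vecs F G)
qed

lemma cmp_cmult:
  assumes F: "F \<in> vecs H"
  shows "(\<lambda>z l. c * F z l) \<in> vecs H" "j \<le> m \<Longrightarrow> cmp (\<lambda>z l. c * F z l) j = (\<lambda>z. c * cmp F j z)"
proof -
  have eq: "(\<lambda>z l. c * F z l) = (\<Sum>j\<le>m. \<Gamma> j (\<lambda>z. c * cmp F j z))"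
    using sum_\<Gamma>_cmult[OF cmp_vecs[OF F]] by (simp add: sum_cmp F)
  show "(\<lambda>z l. c * F z l) \<in> vecs H"
    unfolding eq by (rule sum_vecs_H) (simp add: cmp_vecs F)
  show "j \<le> m \<Longrightarrow> cmp (\<lambda>z l. c * F z l) j = (\<lambda>z. c * cmp F j z)"
    unfolding eq by (rule cmp_sum) (auto simp: cmp_vecs F)
qed

lemma vector_space_H: "vector_space (smul H)"
  unfolding smul_H by unfold_locales (auto simp: fun_eq_iff algebra_simps)

lemma zero_H: "0 \<in> vecs H"
proof -
  have "(\<Sum>j\<le>m. \<Gamma> j (zpow 0)) \<in> vecs H"
    by (rule sum_vecs_H) (simp add: A_space_zpow)
  from cmp_cmult(1)[OF this, of 0] show ?thesis
    by (simp add: zero_fun_def)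
qed

sublocale inner_product_space H
proof (rule inner_product_space.intro)
  show "vector_space (smul H)"
    by (rule vector_space_H)
  then interpret V: vector_space "smul H" .
  show "V.subspace (vecs H)"
    by (rule V.subspaceI) (auto simp: zero_H cmp_add smul_H cmp_cmult)
  show "ip H (x + y) z = ip H x z + ip H y z" if "x \<in> vecs H" "y \<in> vecs H" "z \<in> vecs H" for x y z
    using that by (simp add: ip_H cmp_add cmp_vecs inner_product_space.ip_add_left[OF ips_A]
        sum.distrib algebra_simps)
  show "ip H (smul H c x) y = c * ip H x y" if "x \<in> vecs H" "y \<in> vecs H" for x y c
    using that inner_product_space.ip_smul_left[OF ips_A, of "cmp x _" _ "cmp y _" c]
    by (simp add: ip_H smul_H cmp_cmult cmp_vecs A_space_smul sum_distrib_left mult_ac)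
  show "ip H y x = cnj (ip H x y)" if "x \<in> vecs H" "y \<in> vecs H" for x y
    unfolding ip_H cnj_sum using that
    by (intro sum.cong) (auto simp: cmp_vecs intro!: inner_product_space.ip_commute[OF ips_A])
  show "0 < Re (ip H x x)" if x: "x \<in> vecs H" "x \<noteq> 0" for x
  proof -
    have nn: "Re (of_real (1 / (\<mu> j)\<^sup>2) * ip (A j) (cmp x j) (cmp x j)) \<ge> 0" if "j \<le> m" for j
      using inner_product_space.ip_self(2)[OF ips_A cmp_vecs[OF x(1) that]] by simp
    have "\<exists>j\<le>m. cmp x j \<noteq> 0"
    proof (rule ccontr)
      assume "\<not> ?thesis"
      then have "x z l = 0" for z l
        using H_apply[OF x(1), of z l] by (simp add: zero_fun_def)
      then show False
        using x(2) by (auto simp: fun_eq_iff)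
    qed
    then obtain j where j: "j \<le> m" "cmp x j \<noteq> 0" by blast
    have "0 < Re (of_real (1 / (\<mu> j)\<^sup>2) * ip (A j) (cmp x j) (cmp x j))"
      using inner_product_space.ip_pos[OF ips_A cmp_vecs[OF x(1) j(1)] j(2)] \<mu>_pos[OF j(1)] by simp
    then show ?thesis
      unfolding ip_H Re_sum using nn j(1) by (intro sum_pos2[of _ j]) auto
  qed
qed

text \<open>As a set, the space is the product of the scalar spaces: \<open>dder (l - j)\<close>
  maps \<open>A j\<close> into \<open>A l\<close>, so neither the maps \<open>\<Gamma> j\<close> nor
  forward substitution leave these spaces. Multiplication and division by z can thus be treated in
  each component.\<close>

lemma vecs_H_iff: "F \<in> vecs H \<longleftrightarrow> (\<forall>l\<le>m. (\<lambda>z. F z l) \<in> vecs (A l)) \<and> (\<forall>z. \<forall>l>m. F z l = 0)"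
proof (intro iffI conjI allI impI)
  assume F: "F \<in> vecs H"
  show "F z l = 0" if "m < l" for z l
    using that by (simp add: H_apply[OF F])
  fix l assume l: "l \<le> m"
  interpret A: inner_product_space "A l"
    by (rule ips_A)
  have "(\<lambda>z. F z l) = (\<Sum>j\<le>l. smul (A l) (of_real (gc l j)) (dder (l - j) (cmp F j)))"
    using l by (auto simp: H_apply[OF F] A_space_smul sum_fun_apply sum_gcoef)
  moreover have "dder (l - j) (cmp F j) \<in> vecs (A l)" if "j \<le> l" for j
    using A_space_dder[OF ls_pos cmp_vecs[OF F], of j "l - j"] that l ls_diff[OF that] by simp
  ultimately show "(\<lambda>z. F z l) \<in> vecs (A l)"
    by (auto intro!: A.sum_vecs)
next
  assume F: "(\<forall>l\<le>m. (\<lambda>z. F z l) \<in> vecs (A l)) \<and> (\<forall>z. \<forall>l>m. F z l = 0)"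
  have unG: "unGam lam m F l \<in> vecs (A l)" if "l \<le> m" for l
    using that
  proof (induction l rule: less_induct)
    case (less l)
    interpret A: inner_product_space "A l"
      by (rule ips_A)
    have eq: "unGam lam m F l = (\<lambda>z. F z l)
        - (\<Sum>j<l. smul (A l) (of_real (gc l j)) (dder (l - j) (unGam lam m F j)))"
      by (subst unGam.simps) (simp add: fun_eq_iff A_space_smul sum_fun_apply)
    have "dder (l - j) (unGam lam m F j) \<in> vecs (A l)" if "j < l" for j
      using A_space_dder[OF ls_pos less.IH[OF that], of "l - j"] that less.prems ls_diff[of j l] by simp
    then show ?case
      unfolding eq using F less.prems by (intro A.diff_vecs A.sum_vecs A.smul_vecs) auto
  qed
  have "F z l = (\<Sum>j\<le>m. \<Gamma> j (unGam lam m F j)) z l" for z l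
  proof (cases "l \<le> m")
    case True
    have "dder 0 (unGam lam m F l) z = unGam lam m F l z"
      using dder_0[OF ls_pos unG[OF True]] by simp
    also have "\<dots> = F z l - (\<Sum>j<l. of_real (gc l j) * dder (l - j) (unGam lam m F j) z)"
      by (subst unGam.simps) simp
    finally show ?thesis
      using True sum_gcoef[OF True, of lam "\<lambda>j. dder (l - j) (unGam lam m F j) z"]
      by (simp add: sum_fun_apply Gam_eq lessThan_Suc_atMost[symmetric])
  qed (use F in \<open>auto simp: sum_fun_apply Gam_eq\<close>)
  then have "F = (\<Sum>j\<le>m. \<Gamma> j (unGam lam m F j))"
    by blast
  then show "F \<in> vecs H"
    using sum_vecs_H[of "unGam lam m F"] unG by simp
qed

lemma mult_z_vecs: "F \<in> vecs H \<Longrightarrow> mult_z F \<in> vecs H"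
  by (simp add: vecs_H_iff mult_z_def A_space_mult_z)

lemma mult_z_pow_vecs: "F \<in> vecs H \<Longrightarrow> (mult_z ^^ n) F \<in> vecs H"
  by (induction n) (auto simp: mult_z_vecs)

text \<open>The range of \<open>mult_z\<close> consists of the functions that vanish at 0, so its
  orthogonal complement is governed by values at 0.\<close>

lemma div_z:
  assumes F: "F \<in> vecs H" and F0: "\<And>l. l \<le> m \<Longrightarrow> F 0 l = 0"
  obtains G where "G \<in> vecs H" "F = mult_z G"
proof -
  have "\<exists>g. g \<in> vecs (A l) \<and> (\<forall>z. F z l = z * g z)" if "l \<le> m" for l
    using A_space_div_z[OF ls_pos, of "\<lambda>z. F z l" l] F F0 that unfolding vecs_H_iff by metis
  then obtain g where g: "\<And>l. l \<le> m \<Longrightarrow> g l \<in> vecs (A l)" "\<And>l z. l \<le> m \<Longrightarrow> F z l = z * g l z"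
    by metis
  show ?thesis
  proof
    show "(\<lambda>z l. if l \<le> m then g l z else 0) \<in> vecs H"
      using g(1) by (simp add: vecs_H_iff)
    show "F = mult_z (\<lambda>z l. if l \<le> m then g l z else 0)"
      using g(2) F by (auto simp: fun_eq_iff mult_z_def vecs_H_iff)
  qed
qed

section \<open>Vector monomials and the kernel of the adjoint of multiplication\<close>

definition bv :: "nat \<Rightarrow> nat \<Rightarrow> complex \<Rightarrow> nat \<Rightarrow> complex" where
  "bv n l = (\<lambda>z i. if i = l then zpow n z else 0)"

lemma bv_vecs: "l \<le> m \<Longrightarrow> bv n l \<in> vecs H"
proof -
  interpret A: inner_product_space "A i" for i
    by (rule ips_A)
  have "(\<lambda>z. if i = l then zpow n z else 0) \<in> vecs (A i)" for i
    using A.zero_vecs[of i] by (cases "i = l") (simp_all add: A_space_zpow zero_fun_def)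
  then show "l \<le> m \<Longrightarrow> bv n l \<in> vecs H"
    by (auto simp: vecs_H_iff bv_def)
qed

text \<open>The function representing \<open>F \<mapsto> F(0)\<^sub>w\<close>, that is \<open>K\<^sub>0 \<epsilon>\<^sub>w\<close> for the reproducing kernel \<open>K\<close>.\<close>
definition kv :: "nat \<Rightarrow> complex \<Rightarrow> nat \<Rightarrow> complex" where
  "kv w = (\<Sum>j\<le>m. \<Gamma> j (\<lambda>z. of_real ((\<mu> j)\<^sup>2 * real (w choose j)) * zpow (w - j) z))"

lemma kv_vecs: "kv w \<in> vecs H"
  unfolding kv_def by (rule sum_vecs_H) (simp add: A_space_zpow)

lemma cmp_kv: "j \<le> m \<Longrightarrow> cmp (kv w) j = (\<lambda>z. of_real ((\<mu> j)\<^sup>2 * real (w choose j)) * zpow (w - j) z)"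
  unfolding kv_def by (rule cmp_sum) (auto simp: A_space_zpow)

lemma ip_kv:
  assumes F: "F \<in> vecs H" and w: "w \<le> m"
  shows "ip H F (kv w) = F 0 w"
proof -
  \<comment> \<open>The factor \<open>(\<mu> j)\<^sup>2\<close> in \<open>kv\<close> cancels the
    weight of the inner product. In \<open>weight\<close>, the factorial turns the Taylor
    coefficient into a derivative and the Pochhammer symbol is that of \<open>gc w j\<close>. For
    \<open>j > w\<close> both sides vanish.\<close>
  have "of_real (1 / (\<mu> j)\<^sup>2) * ip (A j) (cmp F j) (cmp (kv w) j)
      = of_real (gc w j) * dder (w - j) (cmp F j) 0" if j: "j \<le> m" for j
  proof -
    have "ip (A j) (cmp F j) (cmp (kv w) j)
        = of_real ((\<mu> j)\<^sup>2 * real (w choose j)) * ip (A j) (cmp F j) (zpow (w - j))"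
      using inner_product_space.ip_smul_right[OF ips_A cmp_vecs[OF F j] A_space_zpow(1)[OF ls_pos],
          of "of_real ((\<mu> j)\<^sup>2 * real (w choose j))" "w - j"]
      by (simp add: cmp_kv[OF j] A_space_smul)
    then show ?thesis
      using \<mu>_pos[OF j] j by (simp add: A_space_zpow(2) cmp_vecs F weight_def taylor_def gcoef_def dder_def)
  qed
  then show ?thesis
    using w by (simp add: ip_H H_apply[OF F])
qed

text \<open>The coefficients of the monomials in \<open>kv w\<close>. For \<open>w \<le> m\<close>,
  \<open>beta w w\<close> is the entry \<open>K(0,0)\<close> at \<open>w\<close>, \<open>w\<close>
  of the reproducing kernel and the squared norm of \<open>kv w\<close>.\<close>

definition beta :: "nat \<Rightarrow> nat \<Rightarrow> real" where
  "beta w l = (\<Sum>j\<le>l. gc l j * ((\<mu> j)\<^sup>2 * real (w choose j) * (fact (w - j) / fact (w - l))))"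

lemma kv_apply: "kv w z l = (if l \<le> m \<and> l \<le> w then of_real (beta w l) * zpow (w - l) z else 0)"
proof (cases "l \<le> m")
  case True
  have "zpow n holomorphic_on disc" for n
    using A_space_zpow(1)[OF ls_pos] A_space_holomorphic[OF ls_pos] by blast
  then have *: "kv w z l = (\<Sum>j\<le>l. of_real (gc l j) * (of_real ((\<mu> j)\<^sup>2 * real (w choose j)) * dder (l - j) (zpow (w - j)) z))"
    unfolding kv_def using True by (simp add: sum_fun_apply Gam_eq dder_cmult sum_gcoef)
  show ?thesis
  proof (cases "l \<le> w")
    case lw: True
    have "dder (l - j) (zpow (w - j)) z = of_real (fact (w - j) / fact (w - l)) * zpow (w - l) z" if "j \<le> l" for j
      using that lw by (simp add: dder_zpow)
    then show ?thesis
      using True lw by (simp add: * beta_def sum_distrib_right mult.assoc)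
  next
    case False
    \<comment> \<open>If \<open>j \<le> w\<close>, the order \<open>l - j\<close> exceeds the degree
      \<open>w - j\<close>; if \<open>j > w\<close>, the binomial coefficient is 0.\<close>
    have "of_real ((\<mu> j)\<^sup>2 * real (w choose j)) * dder (l - j) (zpow (w - j)) z = 0" if "j \<le> l" for j
      using that False by (cases "j \<le> w") (auto simp: dder_zpow)
    then have "kv w z l = 0"
      unfolding * by (intro sum.neutral) (metis mult_zero_right atMost_iff)
    then show ?thesis
      using False by simp
  qed
qed (simp add: kv_def sum_fun_apply Gam_eq)

lemma beta_0: "beta w 0 = 1"
  by (simp add: beta_def \<mu>_0)

lemma beta_diag: "beta w w = (\<mu> w)\<^sup>2 + (\<Sum>j<w. gc w j * ((\<mu> j)\<^sup>2 * real (w choose j) * fact (w - j)))"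
  by (simp add: beta_def lessThan_Suc_atMost[symmetric])

text \<open>Pairing with \<open>kv w'\<close> evaluates component \<open>w'\<close> at 0, and this
  component of \<open>kv w\<close> is zero or a multiple of a monomial of degree
  \<open>w - w'\<close>.\<close>

lemma ip_kv_kv:
  assumes "w \<le> m" "w' \<le> m"
  shows "ip H (kv w) (kv w') = (if w = w' then of_real (beta w w) else 0)"
  using assms by (auto simp: ip_kv kv_vecs kv_apply zpow_def)

lemma beta_diag_pos: "w \<le> m \<Longrightarrow> beta w w > 0"
proof -
  assume w: "w \<le> m"
  have "gc w j \<ge> 0" for j
    by (simp add: gcoef_def pochhammer_nonneg)
  then have "beta w w \<ge> (\<mu> w)\<^sup>2"
    unfolding beta_diag by (simp add: sum_nonneg)
  then show ?thesis
    using \<mu>_pos[OF w] by (smt (verit) zero_less_power)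
qed

text \<open>The kernel of the adjoint of \<^const>\<open>mult_z\<close> is spanned by the functions \<^const>\<open>kv\<close>.\<close>
lemma orthogonal_range_mult_z:
  assumes y: "y \<in> vecs H" and orth: "\<And>F. F \<in> vecs H \<Longrightarrow> ip H y (mult_z F) = 0"
  shows "y = (\<Sum>w\<le>m. smul H (y 0 w / of_real (beta w w)) (kv w))"
proof -
  \<comment> \<open>The coefficients make \<open>s\<close> agree with \<open>y\<close> at 0. Then
    \<open>y - s\<close> is divisible by z, so it lies in the range of \<open>mult_z\<close>; being
    orthogonal to that range, it is orthogonal to itself.\<close>
  define s where "s = (\<Sum>w\<le>m. smul H (y 0 w / of_real (beta w w)) (kv w))"
  have s: "s \<in> vecs H"
    unfolding s_def by (intro sum_vecs smul_vecs kv_vecs)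
  have "s 0 l = y 0 l" if "l \<le> m" for l
  proof -
    have "s 0 l = ip H s (kv l)"
      using s that by (simp add: ip_kv)
    also have "\<dots> = (\<Sum>w\<le>m. y 0 w / of_real (beta w w) * (if w = l then of_real (beta w w) else 0))"
      unfolding s_def using that
      by (subst ip_sum_left) (auto simp: kv_vecs ip_smul_left ip_kv_kv intro!: sum.cong)
    also have "\<dots> = y 0 l"
      using that beta_diag_pos[OF that] by (simp add: if_distrib[of "\<lambda>x. _ * x"] cong: if_cong)
    finally show ?thesis .
  qed
  then have "(y - s) 0 l = 0" if "l \<le> m" for l
    using that by simp
  then obtain G where G: "G \<in> vecs H" "y - s = mult_z G"
    using div_z[of "y - s"] y s by auto
  have "mult_z G 0 w = 0" for w
    by (simp add: mult_z_def)
  then have "ip H (kv w) (mult_z G) = 0" if "w \<le> m" for w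
    using ip_commute[OF mult_z_vecs[OF G(1)] kv_vecs, of w] that
    by (simp add: ip_kv mult_z_vecs G(1))
  then have "ip H s (mult_z G) = 0"
    unfolding s_def using G(1) by (subst ip_sum_left) (auto simp: kv_vecs ip_smul_left mult_z_vecs)
  then have "ip H (y - s) (mult_z G) = 0"
    using orth[OF G(1)] y s G(1) by (simp add: ip_diff_left mult_z_vecs)
  then have "ip H (y - s) (y - s) = 0"
    unfolding G(2) .
  then have "y - s = 0"
    using y s by (intro ip_self_eq_0) auto
  then show ?thesis
    by (simp add: s_def)
qed

end

section \<open>Asymptotics of the powers of the multiplication operator\<close>

lemma ratio_tendsto_1: "(\<lambda>n. (real n + a) / (real n + b)) \<longlonglongrightarrow> 1"
proof -
  have inf: "filterlim (\<lambda>n. real n + b) at_top sequentially"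
    using filterlim_tendsto_add_at_top[OF tendsto_const filterlim_real_sequentially, of b]
    by (simp add: add.commute)
  have "(\<lambda>n. 1 + (a - b) / (real n + b)) \<longlonglongrightarrow> 1 + 0"
    by (intro tendsto_add tendsto_const tendsto_divide_0[OF tendsto_const] filterlim_at_top_imp_at_infinity inf)
  moreover have "\<forall>\<^sub>F n in sequentially. 1 + (a - b) / (real n + b) = (real n + a) / (real n + b)"
    using filterlim_at_top_dense[THEN iffD1, OF inf, THEN spec[of _ 0]]
    by eventually_elim (simp add: field_simps)
  ultimately show ?thesis
    by (simp add: Lim_transform_eventually)
qed

text \<open>For large \<open>n\<close> numerator and denominator are both products of
  \<open>j\<close> factors asymptotic to \<open>n\<close>.\<close>

lemma falling_over_pochhammer: "(\<lambda>n. fact n / fact (n - j) / pochhammer (x + real n) j) \<longlonglongrightarrow> 1"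
proof (induction j)
  case (Suc j)
  have "(\<lambda>n. fact n / fact (n - j) / pochhammer (x + real n) j * ((real n + - real j) / (real n + (x + j)))) \<longlonglongrightarrow> 1 * 1"
    by (intro tendsto_mult Suc ratio_tendsto_1)
  moreover have "\<forall>\<^sub>F n in sequentially.
      fact n / fact (n - j) / pochhammer (x + real n) j * ((real n + - real j) / (real n + (x + j)))
      = fact n / fact (n - Suc j) / pochhammer (x + real n) (Suc j)"
    using eventually_gt_at_top[of j]
  proof eventually_elim
    case (elim n)
    have "fact (n - j) = (real n - real j) * fact (n - Suc j)"
      using elim fact_reduce[of "n - j", where 'a=real] by (simp add: of_nat_diff)
    then show ?case
      using elim by (simp add: pochhammer_Suc add_ac)
  qed
  ultimately show ?case
    by (simp add: Lim_transform_eventually)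
qed simp

lemma fact_ratio_tendsto: "(\<lambda>n. fact (n - l) / fact n :: real) \<longlonglongrightarrow> (if l = 0 then 1 else 0)"
proof (cases "l = 0")
  case False
  have "(\<lambda>n. fact (n - l) / fact n :: real) \<longlonglongrightarrow> 0"
  proof (rule Lim_null_comparison[OF _ lim_inverse_n])
    show "\<forall>\<^sub>F n in sequentially. norm (fact (n - l) / fact n :: real) \<le> inverse (of_nat n)"
      using eventually_gt_at_top[of 0]
    proof eventually_elim
      case (elim n)
      have "(fact (n - l) :: real) \<le> fact (n - 1)"
        using False by (intro fact_mono) auto
      moreover have "(fact n :: real) = n * fact (n - 1)"
        using elim by (simp add: fact_reduce)
      ultimately show ?case
        using elim by (simp add: field_simps)
    qed
  qed
  then show ?thesis
    using False by simp
qed simp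

lemma weight_shift_ratio:
  assumes "\<alpha> > 0"
  shows "(\<lambda>n. weight \<alpha> (n + w) / weight \<alpha> n) \<longlonglongrightarrow> 1"
proof (induction w)
  case 0
  then show ?case
    using weight_pos[OF assms] by (simp add: less_imp_neq[symmetric])
next
  case (Suc w)
  have "(\<lambda>n. weight \<alpha> (n + w) / weight \<alpha> n * ((real n + (real w + 1)) / (real n + (2 * \<alpha> + w)))) \<longlonglongrightarrow> 1 * 1"
    by (intro tendsto_mult Suc ratio_tendsto_1)
  then show ?case
    by (simp add: weight_Suc[OF assms] ac_simps)
qed

text \<open>By the product formula for Gamma, \<open>weight \<alpha> n\<close> is asymptotic to
  \<open>Gamma (2 * \<alpha>)\<close> times \<open>n\<close> to the power
  \<open>1 - 2 * \<alpha>\<close>. A positive limit of the ratio forces equal exponents.\<close>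

lemma weight_ratio_tendsto:
  assumes \<alpha>: "\<alpha> > 0" and \<beta>: "\<beta> > 0" and q: "q > 0"
    and lim: "(\<lambda>n. weight \<beta> n / weight \<alpha> n) \<longlonglongrightarrow> q"
  shows "\<alpha> = \<beta>"
proof -
  define g where "g x n = Gamma_series' x n" for x :: real and n
  have g: "g (2 * \<alpha>) \<longlonglongrightarrow> Gamma (2 * \<alpha>)" "g (2 * \<beta>) \<longlonglongrightarrow> Gamma (2 * \<beta>)"
    unfolding g_def by (rule Gamma_series'_LIMSEQ)+
  have G: "Gamma (2 * \<alpha>) > 0" "Gamma (2 * \<beta>) > 0"
    using \<alpha> \<beta> by (auto intro: Gamma_real_pos)
  have w: "weight \<gamma> n = n * g (2 * \<gamma>) n / exp (2 * \<gamma> * ln n)" if "n > 0" for \<gamma> n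
    using that by (simp add: weight_def g_def Gamma_series'_def fact_reduce)
  have "(\<lambda>n. weight \<beta> n / weight \<alpha> n * (g (2 * \<alpha>) n / g (2 * \<beta>) n)) \<longlonglongrightarrow> q * (Gamma (2 * \<alpha>) / Gamma (2 * \<beta>))"
    using G by (intro tendsto_mult lim tendsto_divide g) auto
  moreover have "\<forall>\<^sub>F n in sequentially. weight \<beta> n / weight \<alpha> n * (g (2 * \<alpha>) n / g (2 * \<beta>) n)
      = exp ((2 * \<alpha> - 2 * \<beta>) * ln n)"
    using eventually_gt_at_top[of 0]
  proof eventually_elim
    case (elim n)
    have "g (2 * \<gamma>) n > 0" if "\<gamma> > 0" for \<gamma>
      using that by (simp add: g_def Gamma_series'_def pochhammer_pos)
    from this[OF \<alpha>] this[OF \<beta>]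
    have "weight \<beta> n / weight \<alpha> n * (g (2 * \<alpha>) n / g (2 * \<beta>) n) = exp (2 * \<alpha> * ln n) / exp (2 * \<beta> * ln n)"
      using elim by (simp add: w[OF elim])
    then show ?case
      by (simp only: exp_diff left_diff_distrib)
  qed
  ultimately have "(\<lambda>n. exp ((2 * \<alpha> - 2 * \<beta>) * ln (real n))) \<longlonglongrightarrow> q * (Gamma (2 * \<alpha>) / Gamma (2 * \<beta>))"
    by (rule Lim_transform_eventually)
  \<comment> \<open>Logarithms divided by \<open>ln n\<close> isolate the exponent
    \<open>2 * \<alpha> - 2 * \<beta>\<close>, which must then be 0.\<close>
  then have "(\<lambda>n. ln (exp ((2 * \<alpha> - 2 * \<beta>) * ln (real n)))) \<longlonglongrightarrow> ln (q * (Gamma (2 * \<alpha>) / Gamma (2 * \<beta>)))"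
    using q G by (intro tendsto_ln) auto
  then have "(\<lambda>n. ln (exp ((2 * \<alpha> - 2 * \<beta>) * ln (real n))) / ln (real n)) \<longlonglongrightarrow> 0"
    by (rule tendsto_divide_0)
      (intro filterlim_at_top_imp_at_infinity filterlim_compose[OF ln_at_top filterlim_real_sequentially])
  moreover have "\<forall>\<^sub>F n in sequentially. ln (exp ((2 * \<alpha> - 2 * \<beta>) * ln (real n))) / ln (real n) = 2 * \<alpha> - 2 * \<beta>"
    using eventually_gt_at_top[of 1] by eventually_elim simp
  ultimately have "(\<lambda>n. 2 * \<alpha> - 2 * \<beta>) \<longlonglongrightarrow> 0"
    by (rule Lim_transform_eventually)
  then show ?thesis
    by (simp add: LIMSEQ_const_iff)
qed

text \<open>Forward substitution for the inverse of the matrix \<open>gcoef\<close>: this is the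
  inverse entry in row \<open>i\<close> and column \<open>l\<close>.\<close>

fun igam :: "real \<Rightarrow> nat \<Rightarrow> nat \<Rightarrow> nat \<Rightarrow> real" where
  "igam lam m l i = (if i = l then 1 else 0) - (\<Sum>j<i. gcoef lam m i j * igam lam m l j)"

declare igam.simps [simp del]

lemma sum_gcoef_igam: "(\<Sum>j\<le>i. gcoef lam m i j * igam lam m l j) = (if i = l then 1 else 0)"
  using igam.simps[of lam m l i] by (simp add: lessThan_Suc_atMost[symmetric])

context inner_product_space
begin

lemma ip_sum_smul:
  assumes x: "\<And>i. i \<in> I \<Longrightarrow> x i \<in> vecs H" and y: "\<And>j. j \<in> J \<Longrightarrow> y j \<in> vecs H"
  shows "ip H (\<Sum>i\<in>I. smul H (a i) (x i)) (\<Sum>j\<in>J. smul H (b j) (y j))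
    = (\<Sum>i\<in>I. \<Sum>j\<in>J. a i * cnj (b j) * ip H (x i) (y j))"
proof -
  have "ip H (x i) (\<Sum>j\<in>J. smul H (b j) (y j)) = (\<Sum>j\<in>J. cnj (b j) * ip H (x i) (y j))" if "i \<in> I" for i
    using x[OF that] y by (subst ip_sum_right) (auto simp: ip_smul_right)
  moreover have "(\<Sum>j\<in>J. smul H (b j) (y j)) \<in> vecs H"
    using y by (intro sum_vecs smul_vecs)
  ultimately show ?thesis
    using x by (subst ip_sum_left) (auto simp: ip_smul_left sum_distrib_left mult.assoc intro!: sum.cong)
qed

end

section \<open>Limits of inner products of shifted vectors\<close>

context bold_space
begin

abbreviation "ig \<equiv> igam lam m"
abbreviation "W \<equiv> weight (ls 0)"

text \<open>\<open>\<Gamma> j\<close> sends the monomial of degree \<open>n - j\<close> to a vector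
  whose component \<open>i\<close> has degree \<open>n - i\<close>. For fixed \<open>n\<close> the
  decomposition therefore reduces to the matrix \<open>ig\<close>; the quotient of factorials
  offsets those from differentiation, and \<open>m \<le> n\<close> keeps the exponents from being
  truncated.\<close>

lemma bv_expand:
  assumes "m \<le> n" "l \<le> m"
  shows "bv (n - l) l = (\<Sum>j\<le>m. \<Gamma> j (\<lambda>z. of_real (ig l j * (fact (n - l) / fact (n - j))) * zpow (n - j) z))"
    (is "_ = ?S")
proof (intro ext)
  fix z i
  have hol: "zpow p holomorphic_on disc" for p
    using A_space_zpow(1)[OF ls_pos] A_space_holomorphic[OF ls_pos] by blast
  show "bv (n - l) l z i = ?S z i"
  proof (cases "i \<le> m")
    case True
    define k where "k j = ig l j * (fact (n - l) / fact (n - j))" for j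
    have "?S z i = (\<Sum>j\<le>m. \<Gamma> j (\<lambda>z. of_real (k j) * zpow (n - j) z)) z i"
      by (simp only: k_def)
    also have "\<dots> = (\<Sum>j\<le>i. of_real (gc i j) * (of_real (k j) * dder (i - j) (zpow (n - j)) z))"
      using True by (simp add: sum_fun_apply Gam_eq dder_cmult[OF hol] sum_gcoef)
    also have "\<dots> = (\<Sum>j\<le>i. of_real (gc i j * ig l j) * (of_real (fact (n - l) / fact (n - i)) * zpow (n - i) z))"
      using True assms by (intro sum.cong) (auto simp: k_def dder_zpow diff_le_mono)
    also have "\<dots> = of_real (\<Sum>j\<le>i. gc i j * ig l j) * (of_real (fact (n - l) / fact (n - i)) * zpow (n - i) z)"
      by (simp only: of_real_sum sum_distrib_right)
    finally show ?thesis
      unfolding sum_gcoef_igam by (simp add: bv_def)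
  qed (use assms in \<open>simp add: sum_fun_apply Gam_eq bv_def\<close>)
qed

lemma ip_bv:
  assumes "m \<le> n" "l \<le> m" "m \<le> n'" "l' \<le> m"
  shows "ip H (bv (n - l) l) (bv (n' - l') l') = (if n = n' then
    of_real (\<Sum>j\<le>m. ig l j * ig l' j / (\<mu> j)\<^sup>2 *
      (fact (n - l) / fact (n - j) * (fact (n - l') / fact (n - j)) * weight (ls j) (n - j))) else 0)"
proof -
  have cmp: "cmp (bv (n - l) l) j = smul (A j) (of_real (ig l j * (fact (n - l) / fact (n - j)))) (zpow (n - j))"
    if "m \<le> n" "l \<le> m" "j \<le> m" for n l j
    unfolding bv_expand[OF that(1,2)] A_space_smul[OF ls_pos]
    by (rule cmp_sum) (use that in \<open>auto simp: A_space_zpow simp del: of_real_mult of_real_divide\<close>)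
  have "ip (A j) (cmp (bv (n - l) l) j) (cmp (bv (n' - l') l') j)
      = (if n = n' then of_real (ig l j * ig l' j *
      (fact (n - l) / fact (n - j) * (fact (n - l') / fact (n - j)) * weight (ls j) (n - j))) else 0)" if j: "j \<le> m" for j
  proof -
    have "n - j = n' - j \<longleftrightarrow> n = n'"
      using j assms by auto
    moreover have "ip (A j) (smul (A j) (of_real a) (zpow p)) (smul (A j) (of_real b) (zpow p'))
        = (if p = p' then of_real (a * b * weight (ls j) p) else 0)" for a b p p'
    proof -
      interpret A: inner_product_space "A j"
        by (rule ips_A)
      have z: "zpow p \<in> vecs (A j)" for p
        by (simp add: A_space_zpow)
      have "ip (A j) (smul (A j) (of_real a) (zpow p)) (smul (A j) (of_real b) (zpow p'))
          = of_real a * (of_real b * ip (A j) (zpow p) (zpow p'))"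
        using A.ip_smul_left[OF z A.smul_vecs[OF z]] A.ip_smul_right[OF z z] by simp
      then show ?thesis
        by (simp add: A_space_zpow(2)[OF ls_pos z] taylor_zpow)
    qed
    ultimately show ?thesis
      using assms j by (simp only: cmp) simp
  qed
  then have *: "of_real (1 / (\<mu> j)\<^sup>2) * ip (A j) (cmp (bv (n - l) l) j) (cmp (bv (n' - l') l') j)
      = (if n = n' then of_real (ig l j * ig l' j / (\<mu> j)\<^sup>2 *
      (fact (n - l) / fact (n - j) * (fact (n - l') / fact (n - j)) * weight (ls j) (n - j))) else 0)"
    if "j \<in> {..m}" for j
    using that by (simp add: mult_ac)
  show ?thesis
  proof (cases "n = n'")
    case True
    then show ?thesis
      unfolding ip_H by (simp only: if_True of_real_sum refl) (rule sum.cong[OF refl], use * True in auto)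
  next
    case False
    then show ?thesis
      unfolding ip_H by (simp only: if_False) (rule sum.neutral, use * False in auto)
  qed
qed

text \<open>The limit of the squared norm of \<open>bv n 0\<close> divided by
  \<open>W n\<close>.\<close>

definition R :: real where
  "R = (\<Sum>j\<le>m. (ig 0 j)\<^sup>2 / (\<mu> j)\<^sup>2 * pochhammer (2 * ls 0) (2 * j))"

lemma R_pos: "R > 0"
proof -
  have "ig 0 0 = 1"
    by (subst igam.simps) simp
  then show ?thesis
    unfolding R_def by (intro sum_pos2[of _ 0]) (auto simp: \<mu>_0 intro!: pochhammer_nonneg divide_nonneg_nonneg mult_nonneg_nonneg)
qed

text \<open>After division by \<open>W n\<close>, the factors \<open>fact (n - l) / fact n\<close>
  remain, which tend to 0 for \<open>l > 0\<close>, next to bounded ones. So only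
  \<open>l = l' = 0\<close> contributes.\<close>

lemma gram_bv_tendsto:
  "(\<lambda>n. (\<Sum>j\<le>m. ig l j * ig l' j / (\<mu> j)\<^sup>2 *
      (fact (n - l) / fact (n - j) * (fact (n - l') / fact (n - j)) * weight (ls j) (n - j))) / W n)
    \<longlonglongrightarrow> (if l = 0 \<and> l' = 0 then R else 0)"
proof -
  let ?\<delta> = "\<lambda>l. if l = (0::nat) then 1 else (0::real)"
  have "(\<lambda>n. (\<Sum>j\<le>m. ig l j * ig l' j / (\<mu> j)\<^sup>2 * (pochhammer (2 * ls 0) (2 * j) *
      (fact (n - l) / fact n * (fact (n - l') / fact n) * (fact n / fact (n - j) / pochhammer (2 * ls 0 + real n) j)))))
    \<longlonglongrightarrow> (\<Sum>j\<le>m. ig l j * ig l' j / (\<mu> j)\<^sup>2 * (pochhammer (2 * ls 0) (2 * j) * (?\<delta> l * ?\<delta> l' * 1)))"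
    by (intro tendsto_sum tendsto_mult tendsto_const fact_ratio_tendsto falling_over_pochhammer)
  also have "(\<Sum>j\<le>m. ig l j * ig l' j / (\<mu> j)\<^sup>2 * (pochhammer (2 * ls 0) (2 * j) * (?\<delta> l * ?\<delta> l' * 1)))
      = (if l = 0 \<and> l' = 0 then R else 0)"
    by (auto simp: R_def power2_eq_square)
  finally have lim: "(\<lambda>n. (\<Sum>j\<le>m. ig l j * ig l' j / (\<mu> j)\<^sup>2 * (pochhammer (2 * ls 0) (2 * j) *
      (fact (n - l) / fact n * (fact (n - l') / fact n) * (fact n / fact (n - j) / pochhammer (2 * ls 0 + real n) j)))))
    \<longlonglongrightarrow> (if l = 0 \<and> l' = 0 then R else 0)" .
  have "\<forall>\<^sub>F n in sequentially. (\<Sum>j\<le>m. ig l j * ig l' j / (\<mu> j)\<^sup>2 * (pochhammer (2 * ls 0) (2 * j) *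
      (fact (n - l) / fact n * (fact (n - l') / fact n) * (fact n / fact (n - j) / pochhammer (2 * ls 0 + real n) j))))
    = (\<Sum>j\<le>m. ig l j * ig l' j / (\<mu> j)\<^sup>2 *
      (fact (n - l) / fact (n - j) * (fact (n - l') / fact (n - j)) * weight (ls j) (n - j))) / W n"
    using eventually_ge_at_top[of m]
  proof eventually_elim
    case (elim n)
    have eq: "pochhammer (2 * ls 0) (2 * j) *
        (fact (n - l) / fact n * (fact (n - l') / fact n) * (fact n / fact (n - j) / pochhammer (2 * ls 0 + real n) j))
      = (fact (n - l) / fact (n - j) * (fact (n - l') / fact (n - j)) * weight (ls j) (n - j)) / W n" if "j \<le> m" for j
    proof -
      \<comment> \<open>\<open>pochhammer (2 * ls 0) (n + j)\<close> is split after
        \<open>2 * j\<close> factors, where the argument becomes \<open>2 * ls j\<close>, and after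
        \<open>n\<close> factors.\<close>
      have "pochhammer (2 * ls 0) (2 * j) * pochhammer (2 * ls j) (n - j) = pochhammer (2 * ls 0) (2 * j + (n - j))"
        using ls_add[of 0 j] by (simp add: pochhammer_product' distrib_left)
      also have "2 * j + (n - j) = n + j"
        using that elim by simp
      finally have p: "pochhammer (2 * ls 0) (2 * j) * pochhammer (2 * ls j) (n - j)
          = pochhammer (2 * ls 0) n * pochhammer (2 * ls 0 + real n) j"
        by (simp add: pochhammer_product')
      have alg: "P * (x / f * (y / f) * (f / g / r)) = (x / g * (y / g) * (g / Q)) / (f / S)"
        if "P * Q = S * r" "Q \<noteq> 0" "r \<noteq> 0" "f \<noteq> 0" "g \<noteq> 0" "S \<noteq> 0" for P x y f g r Q S :: real
        using that by (simp add: divide_simps)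
      show ?thesis
        unfolding weight_def
        by (rule alg[OF p]) (auto intro!: less_imp_neq[symmetric] pochhammer_pos add_pos_nonneg)
    qed
    show ?case
      unfolding sum_divide_distrib by (intro sum.cong refl) (subst eq, auto)
  qed
  with lim show ?thesis
    by (rule Lim_transform_eventually)
qed

lemma ip_bv_tendsto:
  assumes l: "l \<le> m" "l' \<le> m"
  shows "(\<lambda>a. ip H (bv (a + n) l) (bv (a + n') l') / of_real (W a))
    \<longlonglongrightarrow> (if l = 0 \<and> l' = 0 \<and> n = n' then of_real R else 0)"
proof -
  \<comment> \<open>The index in \<open>ip_bv\<close> is exponent plus component, and for large
    \<open>a\<close> vectors with different index are orthogonal.\<close>
  have bv: "bv (a + n) l = bv ((a + (n + l)) - l) l" for a n l
    by simp
  show ?thesis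
  proof (cases "n + l = n' + l'")
    case False
    have "\<forall>\<^sub>F a in sequentially. 0 = ip H (bv (a + n) l) (bv (a + n') l') / of_real (W a)"
      using eventually_ge_at_top[of m]
    proof eventually_elim
      case (elim a)
      show ?case
        unfolding bv[of a n l] bv[of a n' l']
        using elim l False by (subst ip_bv) auto
    qed
    from Lim_transform_eventually[OF tendsto_const this] show ?thesis
      using False by auto
  next
    case True
    define g where "g n = (\<Sum>j\<le>m. ig l j * ig l' j / (\<mu> j)\<^sup>2 *
      (fact (n - l) / fact (n - j) * (fact (n - l') / fact (n - j)) * weight (ls j) (n - j)))" for n
    have "(\<lambda>a. g (a + (n + l)) / W (a + (n + l)) * (W (a + (n + l)) / W a))
        \<longlonglongrightarrow> (if l = 0 \<and> l' = 0 then R else 0) * 1"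
      unfolding g_def
      by (intro tendsto_mult weight_shift_ratio[OF ls_pos] LIMSEQ_ignore_initial_segment[OF gram_bv_tendsto])
    then have "(\<lambda>a. complex_of_real (g (a + (n + l)) / W a)) \<longlonglongrightarrow> of_real (if l = 0 \<and> l' = 0 then R else 0)"
      using weight_pos[OF ls_pos[of 0]] by (intro tendsto_of_real) (simp add: less_imp_neq[symmetric])
    moreover have "\<forall>\<^sub>F a in sequentially. complex_of_real (g (a + (n + l)) / W a)
        = ip H (bv (a + n) l) (bv (a + n') l') / of_real (W a)"
      using eventually_ge_at_top[of m]
    proof eventually_elim
      case (elim a)
      have eq: "a + (n + l) = a + (n' + l')"
        using True by simp
      show ?case
        unfolding bv[of a n l] bv[of a n' l']
        using elim l eq by (subst ip_bv) (auto simp: g_def)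
    qed
    ultimately have "(\<lambda>a. ip H (bv (a + n) l) (bv (a + n') l') / of_real (W a))
        \<longlonglongrightarrow> of_real (if l = 0 \<and> l' = 0 then R else 0)"
      by (rule Lim_transform_eventually)
    then show ?thesis
      using True by (auto split: if_splits)
  qed
qed

lemma mult_z_pow_apply: "(mult_z ^^ a) F z l = z ^ a * F z l"
  by (induction a) (auto simp: mult_z_def)

lemma mult_z_pow_kv: "(mult_z ^^ a) (kv w) = (\<Sum>l\<in>{..min m w}. smul H (of_real (beta w l)) (bv (a + (w - l)) l))"
  by (rule ext, rule ext)
    (auto simp: mult_z_pow_apply kv_apply sum_fun_apply smul_H bv_def zpow_def power_add[symmetric]
      if_distrib[of "\<lambda>x. _ * x"] cong: if_cong)

text \<open>
  Asymptotically only the component 0 counts, in which \<^term>\<open>kv w\<close> is \<open>z\<^sup>w\<close>: the limit is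
  the inner product of \<open>z\<^sup>s\<^sup>+\<^sup>w\<close> and \<open>z\<^sup>s\<^sup>'\<^sup>+\<^sup>w\<^sup>'\<close> on the circle.
\<close>
lemma ip_kv_tendsto:
  "(\<lambda>a. ip H ((mult_z ^^ (a + s)) (kv w)) ((mult_z ^^ (a + s')) (kv w')) / of_real (W a))
    \<longlonglongrightarrow> (if s + w = s' + w' then of_real R else 0)"
proof -
  have "(\<lambda>a. \<Sum>l\<le>min m w. \<Sum>l'\<le>min m w'. of_real (beta w l * beta w' l') *
      (ip H (bv (a + (s + (w - l))) l) (bv (a + (s' + (w' - l'))) l') / of_real (W a)))
    \<longlonglongrightarrow> (\<Sum>l\<le>min m w. \<Sum>l'\<le>min m w'. of_real (beta w l * beta w' l') *
      (if l = 0 \<and> l' = 0 \<and> s + (w - l) = s' + (w' - l') then of_real R else 0))"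
    by (intro tendsto_sum tendsto_mult tendsto_const ip_bv_tendsto) auto
  also have "(\<Sum>l\<le>min m w. \<Sum>l'\<le>min m w'. of_real (beta w l * beta w' l') *
      (if l = 0 \<and> l' = 0 \<and> s + (w - l) = s' + (w' - l') then of_real R else 0))
    = (\<Sum>l\<le>min m w. \<Sum>l'\<le>min m w'. if l' = 0 then if l = 0 then (if s + w = s' + w' then of_real R else 0) else 0 else (0::complex))"
    by (intro sum.cong) (auto simp: beta_0)
  also have "\<dots> = (if s + w = s' + w' then of_real R else 0)"
    by simp
  also have "(\<lambda>a. \<Sum>l\<le>min m w. \<Sum>l'\<le>min m w'. of_real (beta w l * beta w' l') *
      (ip H (bv (a + (s + (w - l))) l) (bv (a + (s' + (w' - l'))) l') / of_real (W a)))
    = (\<lambda>a. ip H ((mult_z ^^ (a + s)) (kv w)) ((mult_z ^^ (a + s')) (kv w')) / of_real (W a))"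
    unfolding mult_z_pow_kv
    by (rule ext, subst ip_sum_smul) (simp_all add: bv_vecs sum_divide_distrib add_ac)
  finally show ?thesis .
qed

definition kvs :: "(nat \<Rightarrow> complex) \<Rightarrow> complex \<Rightarrow> nat \<Rightarrow> complex" where
  "kvs v = (\<Sum>w\<le>m. smul H (v w) (kv w))"

lemma mult_z_pow_kvs: "(mult_z ^^ a) (kvs v) = (\<Sum>w\<le>m. smul H (v w) ((mult_z ^^ a) (kv w)))"
  by (rule ext, rule ext) (simp add: mult_z_pow_apply kvs_def sum_fun_apply smul_H sum_distrib_left mult_ac)

text \<open>The double sum is the circle inner product of the polynomials with coefficients
  \<open>v\<close> and \<open>u\<close>, multiplied by the powers \<open>s\<close> and
  \<open>s'\<close> of z.\<close>

lemma ip_kvs_tendsto: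
  "(\<lambda>a. ip H ((mult_z ^^ (a + s)) (kvs v)) ((mult_z ^^ (a + s')) (kvs u)) / of_real (W a))
    \<longlonglongrightarrow> of_real R * (\<Sum>w\<le>m. \<Sum>w'\<le>m. if s + w = s' + w' then v w * cnj (u w') else 0)"
proof -
  have "(\<lambda>a. \<Sum>w\<le>m. \<Sum>w'\<le>m. v w * cnj (u w') *
      (ip H ((mult_z ^^ (a + s)) (kv w)) ((mult_z ^^ (a + s')) (kv w')) / of_real (W a)))
    \<longlonglongrightarrow> (\<Sum>w\<le>m. \<Sum>w'\<le>m. v w * cnj (u w') * (if s + w = s' + w' then of_real R else 0))"
    by (intro tendsto_sum tendsto_mult tendsto_const ip_kv_tendsto)
  also have "(\<Sum>w\<le>m. \<Sum>w'\<le>m. v w * cnj (u w') * (if s + w = s' + w' then of_real R else 0))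
    = of_real R * (\<Sum>w\<le>m. \<Sum>w'\<le>m. if s + w = s' + w' then v w * cnj (u w') else 0)"
    unfolding sum_distrib_left by (intro sum.cong) auto
  also have "(\<lambda>a. \<Sum>w\<le>m. \<Sum>w'\<le>m. v w * cnj (u w') *
      (ip H ((mult_z ^^ (a + s)) (kv w)) ((mult_z ^^ (a + s')) (kv w')) / of_real (W a)))
    = (\<lambda>a. ip H ((mult_z ^^ (a + s)) (kvs v)) ((mult_z ^^ (a + s')) (kvs u)) / of_real (W a))"
    unfolding mult_z_pow_kvs
    by (rule ext, subst ip_sum_smul) (simp_all add: mult_z_pow_vecs kv_vecs sum_divide_distrib)
  finally show ?thesis .
qed

end

section \<open>Unitary inequivalence\<close>

lemma sum_all_but_one_zero:
  fixes f :: "nat \<Rightarrow> complex"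
  assumes "(\<Sum>w\<le>m. (norm (f w))\<^sup>2) = (norm (f i))\<^sup>2" "i \<le> m" "w \<le> m" "w \<noteq> i"
  shows "f w = 0"
proof -
  have "(\<Sum>w\<in>{..m} - {i}. (norm (f w))\<^sup>2) = 0"
    using assms sum.remove[of "{..m}" i "\<lambda>w. (norm (f w))\<^sup>2"] by simp
  then show ?thesis
    using assms by (subst (asm) sum_nonneg_eq_0_iff) auto
qed

text \<open>
  The polynomials \<open>\<Sum>\<^sub>w v\<^sub>s\<^sub>w z\<^sup>w\<close> on the circle have the same norms and the same inner products
  with the shifts of \<open>v\<^sub>0\<close> as the monomials \<open>\<surd>q z\<^sup>s\<close>. For \<open>s = m\<close> only one term of the inner product
  is left, which forces \<open>v\<^sub>0\<close> to be a constant polynomial.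
\<close>
lemma monomials_of_circle_products:
  fixes v :: "nat \<Rightarrow> nat \<Rightarrow> complex"
  assumes q: "q > 0"
    and norms: "\<And>s. s \<le> m \<Longrightarrow> (\<Sum>w\<le>m. (norm (v s w))\<^sup>2) = q"
    and shifts: "\<And>s. s \<le> m \<Longrightarrow> (\<Sum>w\<le>m. \<Sum>w'\<le>m. if s + w = w' then v 0 w * cnj (v s w') else 0) = of_real q"
    and s: "s \<le> m" "w \<le> m" "w \<noteq> s"
  shows "v s w = 0"
proof -
  have le: "(norm (v s w))\<^sup>2 \<le> q" if "s \<le> m" "w \<le> m" for s w
    unfolding norms[OF that(1), symmetric] using that by (intro member_le_sum) auto
  have inner: "(\<Sum>w'\<le>m. if s + w = w' then v 0 w * cnj (v s w') else 0)
      = (if s + w \<le> m then v 0 w * cnj (v s (s + w)) else 0)" for s w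
    by simp
  \<comment> \<open>The second premise leaves only the term \<open>w = 0\<close>. It is vacuous for
    \<open>s = m\<close>, and holds for every \<open>s\<close> once \<open>v 0\<close> is known to
    be constant.\<close>
  have prod: "(norm (v 0 0))\<^sup>2 * (norm (v s s))\<^sup>2 = q\<^sup>2"
    if "s \<le> m" "\<And>w. w \<noteq> 0 \<Longrightarrow> s + w \<le> m \<Longrightarrow> v 0 w = 0" for s
  proof -
    have "of_real q = (\<Sum>w\<le>m. if s + w \<le> m then v 0 w * cnj (v s (s + w)) else 0)"
      using shifts[OF that(1)] unfolding inner by simp
    also have "\<dots> = (\<Sum>w\<in>{0}. if s + w \<le> m then v 0 w * cnj (v s (s + w)) else 0)"
      using that by (intro sum.mono_neutral_right) auto
    finally have "of_real q = v 0 0 * cnj (v s s)"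
      using that by simp
    then have "norm (complex_of_real q) = norm (v 0 0) * norm (v s s)"
      by (simp add: norm_mult)
    then show ?thesis
      using q by (simp add: power_mult_distrib)
  qed
  \<comment> \<open>Both factors in \<open>prod[of m]\<close> are at most \<open>q\<close>, so the
    first equals \<open>q\<close>; the norm of \<open>v 0\<close> is then used up by its constant
    term.\<close>
  have "q * q \<le> (norm (v 0 0))\<^sup>2 * q"
    using prod[of m] mult_left_mono[OF le[of m m], of "(norm (v 0 0))\<^sup>2"] by (simp add: power2_eq_square)
  then have v00: "(norm (v 0 0))\<^sup>2 = q"
    using le[of 0 0] q by simp
  then have "v 0 w = 0" if "w \<noteq> 0" "w \<le> m" for w
    using sum_all_but_one_zero[of "v 0" m 0 w] norms[of 0] that by simp
  then have "q * (norm (v s s))\<^sup>2 = q\<^sup>2"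
    using prod[OF s(1)] v00 by simp
  then have "(norm (v s s))\<^sup>2 = q"
    using q by (simp add: power2_eq_square)
  then show ?thesis
    using sum_all_but_one_zero[of "v s" m s w] norms s by simp
qed

section \<open>Images of the vectors \<open>kv\<close> under a unitary equivalence\<close>

locale equivalent_bold_spaces =
  X: bold_space m lam \<mu> + Y: bold_space m lam' \<mu>' for m lam \<mu> lam' \<mu>' +
  fixes U
  assumes unitary: "unitary_map X.H Y.H U" and intertwine: "F \<in> vecs X.H \<Longrightarrow> U (mult_z F) = mult_z (U F)"
begin

lemma U_vecs: "F \<in> vecs X.H \<Longrightarrow> U F \<in> vecs Y.H"
  and U_surj: "U ` vecs X.H = vecs Y.H"
  and ip_U: "F \<in> vecs X.H \<Longrightarrow> G \<in> vecs X.H \<Longrightarrow> ip Y.H (U F) (U G) = ip X.H F G"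
  using unitary by (auto simp: unitary_map_def bij_betw_def)

lemma U_mult_z_pow: "F \<in> vecs X.H \<Longrightarrow> U ((mult_z ^^ a) F) = (mult_z ^^ a) (U F)"
  by (induction a) (auto simp: intertwine X.mult_z_pow_vecs)

text \<open>For \<open>w \<le> m\<close> these are Fourier coefficients in the orthogonal family
  \<open>Y.kv w\<close>: the value at 0 is the inner product with \<open>Y.kv w\<close>, and
  \<open>Y.beta w w\<close> is its squared norm.\<close>

definition coords :: "nat \<Rightarrow> nat \<Rightarrow> complex" where
  "coords s w = U (X.kv s) 0 w / of_real (Y.beta w w)"

text \<open>\<open>U\<close> carries the range of \<open>mult_z\<close> onto the range of
  \<open>mult_z\<close>, hence the orthogonal complement into the orthogonal complement.\<close>

lemma U_kv: "s \<le> m \<Longrightarrow> U (X.kv s) = Y.kvs (coords s)"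
  unfolding Y.kvs_def coords_def
proof (rule Y.orthogonal_range_mult_z)
  show "U (X.kv s) \<in> vecs Y.H"
    by (intro U_vecs X.kv_vecs)
  fix G assume s: "s \<le> m" and "G \<in> vecs Y.H"
  then obtain F where F: "F \<in> vecs X.H" "G = U F"
    using U_surj by blast
  have "ip Y.H (U (X.kv s)) (mult_z G) = ip X.H (X.kv s) (mult_z F)"
    unfolding F(2) intertwine[OF F(1), symmetric] by (intro ip_U X.kv_vecs X.mult_z_vecs F)
  also have "\<dots> = cnj (mult_z F 0 s)"
    using s X.ip_commute[OF X.mult_z_vecs[OF F(1)] X.kv_vecs] by (simp add: X.ip_kv X.mult_z_vecs F(1))
  finally show "ip Y.H (U (X.kv s)) (mult_z G) = 0"
    by (simp add: mult_z_def)
qed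

text \<open>The inner products are moved by \<open>U\<close> to the second space, where their limit
  is expressed by the coordinates.\<close>

lemma ip_coords_tendsto:
  assumes "s \<le> m" "t \<le> m"
  shows "(\<lambda>a. ip X.H ((mult_z ^^ (a + d)) (X.kv t)) ((mult_z ^^ a) (X.kv s)) / of_real (Y.W a))
    \<longlonglongrightarrow> of_real Y.R * (\<Sum>w\<le>m. \<Sum>w'\<le>m. if d + w = w' then coords t w * cnj (coords s w') else 0)"
proof -
  have "ip X.H ((mult_z ^^ (a + d)) (X.kv t)) ((mult_z ^^ a) (X.kv s))
      = ip Y.H ((mult_z ^^ (a + d)) (Y.kvs (coords t))) ((mult_z ^^ a) (Y.kvs (coords s)))" for a
    using ip_U[OF X.mult_z_pow_vecs[OF X.kv_vecs] X.mult_z_pow_vecs[OF X.kv_vecs], of "a + d" t a s]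
    by (simp only: U_mult_z_pow[OF X.kv_vecs] U_kv assms)
  then show ?thesis
    using Y.ip_kvs_tendsto[of d "coords t" 0 "coords s"] by simp
qed

lemma norm_sum: "(\<Sum>w\<le>m. \<Sum>w'\<le>m. if 0 + w = w' then f w * cnj (f w') else 0) = of_real (\<Sum>w\<le>m. (norm (f w))\<^sup>2)"
  by (simp add: complex_norm_square[symmetric])

text \<open>The squared norms of the shifts of \<open>X.kv 0\<close>, computed in both spaces, have
  the orders of \<open>X.W\<close> and of \<open>Y.W\<close>. The ratio of these weights thus has a
  positive limit.\<close>

lemma lam_eq: "lam = lam'"
proof -
  define N where "N = (\<Sum>w\<le>m. (norm (coords 0 w))\<^sup>2)"
  define e where "e a = ip X.H ((mult_z ^^ a) (X.kv 0)) ((mult_z ^^ a) (X.kv 0))" for a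
  have eX: "(\<lambda>a. e a / of_real (X.W a)) \<longlonglongrightarrow> of_real X.R"
    using X.ip_kv_tendsto[of 0 0 0 0] by (simp add: e_def)
  have eY: "(\<lambda>a. e a / of_real (Y.W a)) \<longlonglongrightarrow> of_real (Y.R * N)"
    using ip_coords_tendsto[of 0 0 0] by (simp only: norm_sum N_def e_def of_real_mult add_0_right)
  \<comment> \<open>\<open>X.kv 0\<close> has norm 1, so its image is nonzero and the limit
    \<open>Y.R * N\<close> is positive.\<close>
  have "ip Y.H (U (X.kv 0)) (U (X.kv 0)) = of_real (X.beta 0 0)"
    by (simp add: ip_U X.kv_vecs X.ip_kv_kv)
  then have "U (X.kv 0) \<noteq> 0"
    using X.beta_0[of 0] by (auto simp: X.kv_vecs)
  then have "\<exists>w\<le>m. coords 0 w \<noteq> 0"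
    by (rule contrapos_np) (auto simp: U_kv Y.kvs_def)
  then have N: "N > 0"
    unfolding N_def by (auto intro: sum_pos2)
  have "(\<lambda>a. norm (e a / of_real (X.W a) / (e a / of_real (Y.W a)))) \<longlonglongrightarrow> norm (complex_of_real X.R / of_real (Y.R * N))"
    using N Y.R_pos by (intro tendsto_norm tendsto_divide eX eY) auto
  moreover have "\<forall>\<^sub>F a in sequentially. e a / of_real (X.W a) \<noteq> 0"
    using tendsto_imp_eventually_ne[OF eX, of 0] X.R_pos by simp
  then have "\<forall>\<^sub>F a in sequentially. norm (e a / of_real (X.W a) / (e a / of_real (Y.W a))) = Y.W a / X.W a"
    by eventually_elim (simp add: norm_divide weight_pos less_imp_le)
  ultimately have "(\<lambda>a. Y.W a / X.W a) \<longlonglongrightarrow> norm (complex_of_real X.R / of_real (Y.R * N))"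
    by (rule Lim_transform_eventually)
  then have "X.ls 0 = Y.ls 0"
    using N X.R_pos Y.R_pos by (intro weight_ratio_tendsto) auto
  then show ?thesis
    by (simp add: lam_shift_def)
qed

text \<open>By \<open>lam_eq\<close> both spaces have the same \<open>W\<close>, so the limits
  computed in either space can be equated.\<close>

lemma coords_products:
  assumes "s \<le> m" "t \<le> m"
  shows "(\<Sum>w\<le>m. \<Sum>w'\<le>m. if d + w = w' then coords t w * cnj (coords s w') else 0)
      = (if d + t = s then of_real (X.R / Y.R) else 0)"
proof -
  have "(\<lambda>a. ip X.H ((mult_z ^^ (a + d)) (X.kv t)) ((mult_z ^^ a) (X.kv s)) / of_real (Y.W a))
      \<longlonglongrightarrow> (if d + t = s then of_real X.R else 0)"
    using X.ip_kv_tendsto[of d t 0 s] lam_eq by simp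
  from LIMSEQ_unique[OF ip_coords_tendsto[OF assms] this] show ?thesis
    using Y.R_pos by (simp add: field_simps split: if_splits)
qed

lemma coords_norm:
  assumes "s \<le> m"
  shows "(\<Sum>w\<le>m. (norm (coords s w))\<^sup>2) = X.R / Y.R"
  using coords_products[OF assms assms, of 0] unfolding norm_sum by (simp only: of_real_eq_iff add_0 if_True refl)

lemma coords_off_diagonal: "s \<le> m \<Longrightarrow> w \<le> m \<Longrightarrow> w \<noteq> s \<Longrightarrow> coords s w = 0"
proof (rule monomials_of_circle_products[where q = "X.R / Y.R" and m = m])
  show "X.R / Y.R > 0"
    using X.R_pos Y.R_pos by simp
  show "(\<Sum>w\<le>m. (norm (coords s w))\<^sup>2) = X.R / Y.R" if "s \<le> m" for s
    by (rule coords_norm[OF that])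
  show "(\<Sum>w\<le>m. \<Sum>w'\<le>m. if s + w = w' then coords 0 w * cnj (coords s w') else 0) = of_real (X.R / Y.R)"
    if "s \<le> m" for s
    using coords_products[OF that, of 0 s] by simp
qed

lemma beta_eq:
  assumes "s \<le> m"
  shows "X.beta s s = Y.beta s s"
proof -
  have beta: "X.beta s s = X.R / Y.R * Y.beta s s" if s: "s \<le> m" for s
  proof -
    have "Y.kvs (coords s) = (\<Sum>w\<in>{s}. smul Y.H (coords s w) (Y.kv w))"
      unfolding Y.kvs_def using coords_off_diagonal[OF s] s by (intro sum.mono_neutral_right) auto
    then have "complex_of_real (X.beta s s) = ip Y.H (smul Y.H (coords s s) (Y.kv s)) (smul Y.H (coords s s) (Y.kv s))"
      using ip_U[OF X.kv_vecs X.kv_vecs, of s s] s by (simp add: U_kv X.ip_kv_kv)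
    also have "\<dots> = of_real ((norm (coords s s))\<^sup>2) * of_real (Y.beta s s)"
      unfolding complex_norm_square using s
      by (simp add: Y.ip_smul_left Y.ip_smul_right Y.kv_vecs Y.ip_kv_kv)
    also have "(norm (coords s s))\<^sup>2 = (\<Sum>w\<in>{s}. (norm (coords s w))\<^sup>2)"
      by simp
    also have "\<dots> = X.R / Y.R"
      unfolding coords_norm[OF s, symmetric] using coords_off_diagonal[OF s] s
      by (intro sum.mono_neutral_left) auto
    finally show ?thesis
      by (simp only: of_real_mult[symmetric] of_real_eq_iff)
  qed
  \<comment> \<open>\<open>beta 0 0 = 1\<close> in both spaces, because \<open>\<mu> 0 = 1\<close>
    and \<open>\<mu>' 0 = 1\<close>; this fixes the common factor.\<close>
  from beta[of 0] have "X.R / Y.R = 1"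
    by (simp add: X.beta_0 Y.beta_0)
  then show ?thesis
    using beta[OF assms] by simp
qed

text \<open>\<open>beta s s\<close> is \<open>(\<mu> s)\<^sup>2\<close> plus a combination of
  earlier squares whose coefficients depend on \<open>lam\<close> and \<open>m\<close> only, so the
  parameters are recovered one after another.\<close>

lemma mu_eq: "s \<le> m \<Longrightarrow> \<mu> s = \<mu>' s"
proof (induction s rule: less_induct)
  case (less s)
  have "(\<Sum>j<s. X.gc s j * ((\<mu> j)\<^sup>2 * real (s choose j) * fact (s - j)))
      = (\<Sum>j<s. Y.gc s j * ((\<mu>' j)\<^sup>2 * real (s choose j) * fact (s - j)))"
    using less by (intro sum.cong) (auto simp: lam_eq)
  then have "(\<mu> s)\<^sup>2 = (\<mu>' s)\<^sup>2"
    using beta_eq[OF less.prems] unfolding X.beta_diag Y.beta_diag by simp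
  then show ?case
    using X.\<mu>_pos[OF less.prems] Y.\<mu>_pos[OF less.prems] by simp
qed

end

theorem theorem6p2:
  fixes m :: nat and lam lam' :: real and \<mu> \<mu>' :: "nat \<Rightarrow> real"
  assumes "m \<ge> 1"
    and "lam > real m / 2" and "lam' > real m / 2"
    and "\<mu> 0 = 1" and "\<And>j. 1 \<le> j \<Longrightarrow> j \<le> m \<Longrightarrow> \<mu> j > 0"
    and "\<mu>' 0 = 1" and "\<And>j. 1 \<le> j \<Longrightarrow> j \<le> m \<Longrightarrow> \<mu>' j > 0"
    and "lam \<noteq> lam' \<or> (\<exists>j\<le>m. \<mu> j \<noteq> \<mu>' j)"
  shows "\<not> unitarily_equivalent (bold_A_space m lam \<mu>) mult_z (bold_A_space m lam' \<mu>') mult_z"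
proof
  assume "unitarily_equivalent (bold_A_space m lam \<mu>) mult_z (bold_A_space m lam' \<mu>') mult_z"
  then obtain U where U: "unitary_map (bold_A_space m lam \<mu>) (bold_A_space m lam' \<mu>') U"
    "\<And>F. F \<in> vecs (bold_A_space m lam \<mu>) \<Longrightarrow> U (mult_z F) = mult_z (U F)"
    unfolding unitarily_equivalent_def by blast
  have "\<mu> j > 0" "\<mu>' j > 0" if "j \<le> m" for j
    using assms(4-7) that by (cases "j = 0"; simp)+
  then interpret equivalent_bold_spaces m lam \<mu> lam' \<mu>' U
    using assms(2-4,6) U by unfold_locales auto
  show False
    using assms(8) lam_eq mu_eq by blast
qed

end
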